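(* Let $\rho:\mathbb{R}\to\mathbb{R}$ be an increasing function with $\rho(0)=0$. For $g:\mathbb{R}^n\to\mathbb{R}$ Borel measurable define $\mathcal{T}g:\mathbb{R}^n\to\mathbb{R}\cup\{\infty\}$ by $$\mathcal{T}g(x)=\sup_{y\in\mathbb{R}^n}\big[\rho(\langle x,y\rangle)-g(y)\big].$$ If $f:\mathbb{R}^n\to[0,\infty)$ is convex, even and $f(0)=0$, and $f_*$ denotes its spherically symmetric increasing rearrangement, then $$|\{\mathcal{T}f\le\lambda\}|\ \le\ |\{\mathcal{T}f_*\le\lambda\}|\qquad\text{for all }\lambda\in\mathbb{R}.$$
   Context: $|\cdot|$ is Lebesgue measure on $\mathbb{R}^n$ and $\langle\cdot,\cdot\rangle$ the Euclidean scalar product. For a Borel set $A\subseteq\mathbb{R}^n$, $A^*=\{x:\|x\|<r\}$ is the open Euclidean ball centered at $0$ with $|A^*|=|A|$ (so $A^*=\emptyset$ if $|A|=0$ and $A^*=\mathbb{R}^n$ if $|A|=\infty$). For measurable $g\ge0$, $g^*(y)=\int_0^\infty\mathbf{1}_{\{g>s\}^*}(y)\,ds$. The spherically symmetric increasing rearrangement of a measurable $f:\mathbb{R}^n\to\mathbb{R}$ is $f_*=-\log\big((e^{-f})^*\big)$; it satisfies $\{f_*<\lambda\}=\{f<\lambda\}^*$ for all $\lambda\in\mathbb{R}$. *)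

theory Defs
  imports "HOL-Analysis.Analysis"
begin

text \<open>The radius is well defined (for every Lebesgue measurable set of finite measure) because
  the volume of a ball is a continuous strictly increasing function of the radius
  \<open>r \<ge> 0\<close>; see \<open>ball_rearr_eq_ball\<close>.\<close>

definition ball_rearr :: "(real ^ 'n) set \<Rightarrow> (real ^ 'n) set" where
  "ball_rearr A =
     (if emeasure lebesgue A = \<infinity> then UNIV
      else {x. norm x < (THE r. 0 \<le> r \<and> emeasure lebesgue {x :: real ^ 'n. norm x < r} = emeasure lebesgue A)})"

definition decr_rearr :: "(real ^ 'n \<Rightarrow> real) \<Rightarrow> real ^ 'n \<Rightarrow> ennreal" where
  "decr_rearr g y = (\<integral>\<^sup>+s\<in>{0<..}. indicator (ball_rearr {x. g x > s}) y \<partial>lborel)"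

text \<open>The value of \<^const>\<open>decr_rearr\<close> at \<open>\<lambda>x. exp (- f x)\<close> may be \<open>0\<close> or
  \<open>\<infinity>\<close> for arbitrary \<open>f\<close>, and then \<open>incr_rearr f\<close> carries no meaning. For measurable
  \<open>f \<ge> 0\<close> this does not happen, see \<open>decr_rearr_exp_bounds\<close>.\<close>

definition incr_rearr :: "(real ^ 'n \<Rightarrow> real) \<Rightarrow> real ^ 'n \<Rightarrow> real" where
  "incr_rearr f y = - ln (enn2real (decr_rearr (\<lambda>x. exp (- f x)) y))"

definition legendre_transform ::
    "(real \<Rightarrow> real) \<Rightarrow> (real ^ 'n \<Rightarrow> real) \<Rightarrow> real ^ 'n \<Rightarrow> ereal" where
  "legendre_transform \<rho> g x = (SUP y. ereal (\<rho> (x \<bullet> y) - g y))"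

lemma emeasure_norm_less:
  assumes "0 \<le> r"
  shows "emeasure lebesgue {x :: real ^ 'n. norm x < r} = ennreal (unit_ball_vol CARD('n) * r ^ CARD('n))"
proof -
  have "{x :: real ^ 'n. norm x < r} = ball 0 r" by auto
  then show ?thesis using emeasure_ball[OF assms, of "0 :: real ^ 'n"] by simp
qed

lemma emeasure_norm_less_mono_iff:
  assumes "0 \<le> r" "0 \<le> s"
  shows "emeasure lebesgue {x :: real ^ 'n. norm x < r} < emeasure lebesgue {x :: real ^ 'n. norm x < s}
           \<longleftrightarrow> r < s"
proof -
  have u: "unit_ball_vol (real CARD('n)) > 0" by simp
  have "r ^ CARD('n) < s ^ CARD('n) \<longleftrightarrow> r < s"
    using assms by (simp add: power_strict_mono power_less_imp_less_base iffI
        power_mono_iff linorder_not_le[symmetric])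
  moreover have "ennreal (unit_ball_vol CARD('n) * r ^ CARD('n)) < ennreal (unit_ball_vol CARD('n) * s ^ CARD('n))
      \<longleftrightarrow> r ^ CARD('n) < s ^ CARD('n)"
    using u assms by (subst ennreal_less_iff) (auto simp: mult_less_cancel_left_pos)
  ultimately show ?thesis by (simp only: emeasure_norm_less assms)
qed

lemma ball_rearr_eq_ball:
  fixes A :: "(real ^ 'n) set"
  assumes "emeasure lebesgue A \<noteq> \<infinity>"
  obtains r where "0 \<le> r" "ball_rearr A = {x. norm x < r}"
    "emeasure lebesgue {x :: real ^ 'n. norm x < r} = emeasure lebesgue A"
proof -
  define v where "v = unit_ball_vol (real CARD('n))"
  define m where "m = enn2real (emeasure lebesgue A)"
  define r where "r = root CARD('n) (m / v)"
  have v: "v > 0" by (simp add: v_def)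
  have m: "0 \<le> m" "emeasure lebesgue A = ennreal m"
    using assms by (auto simp: m_def less_top)
  have r: "0 \<le> r" using m v by (simp add: r_def)
  have "r ^ CARD('n) = m / v"
    unfolding r_def using m v by (subst real_root_pow_pos2) auto
  then have e: "emeasure lebesgue {x :: real ^ 'n. norm x < r} = emeasure lebesgue A"
    unfolding emeasure_norm_less[OF r] m(2) v_def[symmetric] using v by simp
  have uniq: "s = r" if "0 \<le> s" "emeasure lebesgue {x :: real ^ 'n. norm x < s} = emeasure lebesgue A" for s
    using emeasure_norm_less_mono_iff[OF that(1) r, where 'n = 'n]
      emeasure_norm_less_mono_iff[OF r that(1), where 'n = 'n]
    unfolding that(2) e by simp
  have "(THE r. 0 \<le> r \<and> emeasure lebesgue {x :: real ^ 'n. norm x < r} = emeasure lebesgue A) = r"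
    by (rule the_equality) (blast intro: r e uniq)+
  then have "ball_rearr A = {x. norm x < r}" using assms by (simp add: ball_rearr_def)
  then show ?thesis using that r e by blast
qed

lemma mem_ball_rearr_iff:
  fixes A :: "(real ^ 'n) set"
  shows "y \<in> ball_rearr A \<longleftrightarrow> emeasure lebesgue {x :: real ^ 'n. norm x < norm y} < emeasure lebesgue A"
proof (cases "emeasure lebesgue A = \<infinity>")
  case True
  then show ?thesis
    unfolding emeasure_norm_less[OF norm_ge_zero] by (simp add: ball_rearr_def)
next
  case False
  then obtain r where "0 \<le> r" "ball_rearr A = {x. norm x < r}"
    "emeasure lebesgue {x :: real ^ 'n. norm x < r} = emeasure lebesgue A"
    by (rule ball_rearr_eq_ball)
  then show ?thesis using emeasure_norm_less_mono_iff[of "norm y" r, where 'n = 'n] by simp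
qed

lemma less_decr_rearr_iff:
  fixes g :: "real ^ 'n \<Rightarrow> real"
  assumes g: "g \<in> borel_measurable borel" and t: "0 \<le> t"
  shows "ennreal t < decr_rearr g y \<longleftrightarrow> y \<in> ball_rearr {x. g x > t}"
proof
  have meas: "{x. g x > s} \<in> sets lebesgue" for s
  proof -
    have "{x. g x > s} \<in> sets borel" using g by measurable
    then show ?thesis by simp
  qed
  have anti: "y \<in> ball_rearr {x. g x > s}" if "y \<in> ball_rearr {x. g x > s'}" "s \<le> s'" for s s'
  proof -
    have "emeasure lebesgue {x. g x > s'} \<le> emeasure lebesgue {x. g x > s}"
      using that meas by (intro emeasure_mono) auto
    then show ?thesis using that(1) by (simp add: mem_ball_rearr_iff)
  qed
  show "ennreal t < decr_rearr g y" if "y \<in> ball_rearr {x. g x > t}"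
  proof -
    have U: "{x. g x > t} = (\<Union>i. {x. g x > t + 1 / real (Suc i)})"
    proof (intro equalityI subsetI)
      fix x assume "x \<in> {x. g x > t}"
      then obtain i where "1 / real (Suc i) < g x - t"
        using reals_Archimedean[of "g x - t"] by (auto simp: inverse_eq_divide)
      then show "x \<in> (\<Union>i. {x. g x > t + 1 / real (Suc i)})" by (auto intro!: exI[of _ i])
    next
      fix x assume "x \<in> (\<Union>i. {x. g x > t + 1 / real (Suc i)})"
      then obtain i where i: "t + 1 / real (Suc i) < g x" by auto
      have "0 < 1 / real (Suc i)" by simp
      then have "t < g x" using i by linarith
      then show "x \<in> {x. g x > t}" by simp
    qed
    have inc: "incseq (\<lambda>i. {x. g x > t + 1 / real (Suc i)})"
    proof (intro incseq_SucI subsetI)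
      fix i x assume "x \<in> {x. g x > t + 1 / real (Suc i)}"
      moreover have "1 / real (Suc (Suc i)) \<le> 1 / real (Suc i)" by (simp add: frac_le)
      ultimately have "t + 1 / real (Suc (Suc i)) < g x" by (simp only: mem_Collect_eq)
      then show "x \<in> {x. g x > t + 1 / real (Suc (Suc i))}" by simp
    qed
    have sup: "emeasure lebesgue {x. g x > t} = (SUP i. emeasure lebesgue {x. g x > t + 1 / real (Suc i)})"
      unfolding U using meas inc by (intro SUP_emeasure_incseq[symmetric]) auto
    then have "\<exists>i. y \<in> ball_rearr {x. g x > t + 1 / real (Suc i)}"
      using that by (simp only: mem_ball_rearr_iff less_SUP_iff bex_UNIV)
    then obtain i where "y \<in> ball_rearr {x. g x > t + 1 / real (Suc i)}" ..
    moreover define t' where "t' = t + 1 / real (Suc i)"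
    ultimately have t': "t < t'" "y \<in> ball_rearr {x. g x > t'}" by simp_all
    have "ennreal t < ennreal t'" using t t' by (simp add: ennreal_less_iff)
    also have "ennreal t' = (\<integral>\<^sup>+s. indicator {0<..t'} s \<partial>lborel)" using t t' by simp
    also have "\<dots> \<le> decr_rearr g y"
      unfolding decr_rearr_def using anti[OF t'(2)]
      by (intro nn_integral_mono) (auto split: split_indicator)
    finally show ?thesis .
  qed
  show "y \<in> ball_rearr {x. g x > t}" if "ennreal t < decr_rearr g y"
  proof (rule ccontr)
    assume n: "y \<notin> ball_rearr {x. g x > t}"
    have "decr_rearr g y \<le> (\<integral>\<^sup>+s. indicator {0<..t} s \<partial>lborel)"
      unfolding decr_rearr_def
    proof (intro nn_integral_mono)
      fix s :: real
      show "(indicator (ball_rearr {x. g x > s}) y :: ennreal) * indicator {0<..} s \<le> indicator {0<..t} s"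
        using n anti[of s t]
        by (cases "s \<le> t") (auto simp: not_le dest: anti[OF _ less_imp_le] split: split_indicator)
    qed
    also have "\<dots> = ennreal t" using t by simp
    finally show False using that by simp
  qed
qed

lemma decr_rearr_exp_bounds:
  fixes f :: "real ^ 'n \<Rightarrow> real"
  assumes "f \<in> borel_measurable borel" "\<And>x. 0 \<le> f x"
  shows "0 < decr_rearr (\<lambda>x. exp (- f x)) y" "decr_rearr (\<lambda>x. exp (- f x)) y \<le> 1"
proof -
  have g: "(\<lambda>x. exp (- f x)) \<in> borel_measurable borel" using assms(1) by measurable
  show "0 < decr_rearr (\<lambda>x. exp (- f x)) y"
    using less_decr_rearr_iff[OF g, of 0 y] by (simp add: ball_rearr_def)
  show "decr_rearr (\<lambda>x. exp (- f x)) y \<le> 1"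
    using less_decr_rearr_iff[OF g, of 1 y] assms(2)
    by (simp add: mem_ball_rearr_iff not_less[symmetric])
qed

lemma incr_rearr_sublevel:
  fixes f :: "real ^ 'n \<Rightarrow> real"
  assumes "f \<in> borel_measurable borel" "\<And>x. 0 \<le> f x"
  shows "{y. incr_rearr f y < l} = ball_rearr {x. f x < l}"
proof -
  have g: "(\<lambda>x. exp (- f x)) \<in> borel_measurable borel" using assms(1) by measurable
  have "incr_rearr f y < l \<longleftrightarrow> y \<in> ball_rearr {x. f x < l}" for y
  proof -
    define d where "d = enn2real (decr_rearr (\<lambda>x. exp (- f x)) y)"
    have fin: "decr_rearr (\<lambda>x. exp (- f x)) y < top"
      by (rule le_less_trans[OF decr_rearr_exp_bounds(2)[OF assms]]) simp
    then have d: "0 < d" "decr_rearr (\<lambda>x. exp (- f x)) y = ennreal d"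
      using decr_rearr_exp_bounds[OF assms, of y] by (auto simp: d_def enn2real_positive_iff)
    have "incr_rearr f y < l \<longleftrightarrow> exp (- l) < d"
      using d(1) ln_less_cancel_iff[of "exp (- l)" d] by (auto simp: incr_rearr_def d_def[symmetric])
    also have "\<dots> \<longleftrightarrow> ennreal (exp (- l)) < decr_rearr (\<lambda>x. exp (- f x)) y"
      by (simp add: d(2) ennreal_less_iff)
    also have "\<dots> \<longleftrightarrow> y \<in> ball_rearr {x. exp (- f x) > exp (- l)}"
      by (rule less_decr_rearr_iff[OF g]) simp
    finally show ?thesis by simp
  qed
  then show ?thesis by auto
qed

end

theory Submission
  imports Defs
begin

text \<open>Write \<open>L\<close> and \<open>L'\<close> for the sublevel sets at height \<open>l\<close> of the transforms of \<open>f\<close> and of its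
  rearrangement. A point \<open>x\<close> lies in \<open>L\<close> iff \<open>\<rho> \<langle>x, y\<rangle> \<le> l + f y\<close> for all \<open>y\<close>, and likewise for
  \<open>L'\<close>. The proof shows that the ball with the volume of \<open>L\<close> is contained in \<open>L'\<close>. Suppose that
  \<open>x0\<close> is not in \<open>L'\<close>. Then \<open>\<rho> \<langle>x0, y0\<rangle> = l + t\<close> for some \<open>y0\<close> and some \<open>t\<close> above the value of the
  rearrangement at \<open>y0\<close>. The set \<open>K = {f < t}\<close> is symmetric, open, and larger than
  the ball of radius \<open>norm y0\<close>. As \<open>\<rho>\<close> is increasing, \<open>\<langle>x, y\<rangle> < \<langle>x0, y0\<rangle> \<le> norm x0 * norm y0\<close> for
  \<open>x\<close> in \<open>L\<close> and \<open>y\<close> in \<open>K\<close>. The Blaschke-Santalo inequality \<open>blaschke_santalo\<close> says that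
  the product of the volumes of \<open>K\<close> and \<open>L\<close> is then at most the product of the volumes of the balls of
  radii \<open>norm x0\<close> and \<open>norm y0\<close>. Hence \<open>L\<close> is not larger than the ball of radius \<open>norm x0\<close>, that
  is, \<open>x0\<close> is not in the ball with the volume of \<open>L\<close>.

  The Blaschke-Santalo inequality is proved by induction on the dimension, for symmetric open sets
  \<open>K\<close> and \<open>L\<close> with inner products at most \<open>c\<close> (\<open>santalo_coord\<close>). In one coordinate direction \<open>K\<close> is
  replaced by its Steiner symmetral, and each slice \<open>A\<close> of \<open>L\<close> orthogonal to this direction by
  \<open>(A - A) / 2\<close>. Neither operation decreases the volume, by the Brunn-Minkowski inequality on the
  line and in one dimension less. Afterwards the slices of the two sets are symmetric in the hyperplane,
  and the slices at heights \<open>s\<close> and \<open>t\<close> have inner products at most \<open>c - s t\<close>, so the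
  induction hypothesis bounds the product of their volumes by the squared volume of the slice of the
  ball at height \<open>sqrt (s t)\<close>. The Prekopa-Leindler inequality on the half-line, with
  geometric means in place of midpoints (\<open>prekopa_leindler_geometric_mean\<close>), integrates this bound.

  Open sets are used throughout because openness passes to slices and to both constructions and
  guarantees measurability.\<close>

section \<open>One-dimensional Brunn-Minkowski and Prekopa-Leindler inequalities\<close>

text \<open>If \<open>a\<close> is almost the supremum of \<open>A\<close> and \<open>b\<close> almost the infimum of \<open>B\<close>, then the
  translates \<open>A + b\<close> and \<open>a + B\<close> both lie in \<open>2 C\<close>, and they overlap only in a short interval
  around \<open>a + b\<close>. The extrema need only be attained approximately, so arbitrary Borel sets can be
  treated directly.\<close>

lemma brunn_minkowski_real_bounded:
  fixes A B C :: "real set"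
  assumes [measurable]: "A \<in> sets borel" "B \<in> sets borel" "C \<in> sets borel"
    and ne: "A \<noteq> {}" "B \<noteq> {}" and bd: "bounded A" "bounded B"
    and mid: "\<And>a b. a \<in> A \<Longrightarrow> b \<in> B \<Longrightarrow> (a + b) / 2 \<in> C"
  shows "emeasure lborel A + emeasure lborel B \<le> 2 * emeasure lborel C"
proof (rule ennreal_le_epsilon)
  fix e :: real assume e: "0 < e"
  have bdd: "bdd_above A" "bdd_below B"
    using bd by (auto simp: bounded_imp_bdd_above bounded_imp_bdd_below)
  obtain a where a: "a \<in> A" "Sup A - e / 2 < a"
    using less_cSup_iff[OF ne(1) bdd(1), of "Sup A - e / 2"] e by auto
  obtain b where b: "b \<in> B" "b < Inf B + e / 2"
    using cInf_less_iff[OF ne(2) bdd(2), of "Inf B + e / 2"] e by auto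
  define C' where "C' = (\<lambda>u. u / 2) -` C"
  define A' where "A' = (\<lambda>u. u - b) -` A"
  define B' where "B' = (\<lambda>u. u - a) -` B"
  have [measurable]: "A' \<in> sets borel" "B' \<in> sets borel" "C' \<in> sets borel"
    unfolding A'_def B'_def C'_def by (auto intro!: measurable_sets_borel[of _ borel])
  have shift: "emeasure lborel ((\<lambda>u. u - c) -` S) = emeasure lborel S"
    if [measurable]: "S \<in> sets borel" for S and c :: real
  proof -
    have [measurable]: "(\<lambda>u. u - c) -` S \<in> sets borel"
      by (auto intro!: measurable_sets_borel[of _ borel])
    have "emeasure lborel ((\<lambda>u. u - c) -` S) = (\<integral>\<^sup>+x. indicator ((\<lambda>u. u - c) -` S) x \<partial>lborel)"
      by simp
    also have "\<dots> = (\<integral>\<^sup>+x. indicator S (x - c) \<partial>lborel)"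
      by (intro nn_integral_cong) (auto split: split_indicator)
    also have "\<dots> = (\<integral>\<^sup>+x. indicator S x \<partial>lborel)"
      by (subst (2) nn_integral_real_affine[where t = "-c" and c = 1]) auto
    finally show ?thesis by simp
  qed
  have sub: "A' \<union> B' \<subseteq> C'"
  proof -
    have "u \<in> C'" if "u - b \<in> A" for u
      using mid[OF that b(1)] by (simp add: C'_def)
    moreover have "u \<in> C'" if "u - a \<in> B" for u
      using mid[OF a(1) that] by (simp add: C'_def)
    ultimately show ?thesis by (auto simp: A'_def B'_def)
  qed
  have int: "A' \<inter> B' \<subseteq> {a + Inf B .. Sup A + b}"
  proof
    fix u assume "u \<in> A' \<inter> B'"
    then have "u - b \<le> Sup A" "Inf B \<le> u - a"
      using bdd by (auto simp: A'_def B'_def intro: cSup_upper cInf_lower)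
    then show "u \<in> {a + Inf B .. Sup A + b}" by auto
  qed
  have "emeasure lborel A + emeasure lborel B = emeasure lborel A' + emeasure lborel B'"
    by (simp add: A'_def B'_def shift)
  also have "\<dots> = emeasure lborel (A' \<union> B') + emeasure lborel (A' \<inter> B')"
    by (rule emeasure_Un_Int) auto
  also have "\<dots> \<le> emeasure lborel C' + emeasure lborel {a + Inf B .. Sup A + b}"
    using sub int by (intro add_mono emeasure_mono) auto
  also have "\<dots> \<le> emeasure lborel C' + ennreal e"
    using a b e by (intro add_mono) (auto simp: emeasure_lborel_Icc_eq intro!: ennreal_leI)
  also have "emeasure lborel C' = 2 * emeasure lborel C"
  proof -
    have "emeasure lborel C' = (\<integral>\<^sup>+x. indicator C' x \<partial>lborel)"
      by simp
    also have "\<dots> = (\<integral>\<^sup>+x. indicator C (x / 2) \<partial>lborel)"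
      by (intro nn_integral_cong) (auto simp: C'_def split: split_indicator)
    also have "\<dots> = ennreal \<bar>2\<bar> * (\<integral>\<^sup>+x. indicator C x \<partial>lborel)"
      by (subst nn_integral_real_affine[where t = 0 and c = 2]) auto
    finally show ?thesis by simp
  qed
  finally show "emeasure lborel A + emeasure lborel B \<le> 2 * emeasure lborel C + ennreal e" .
qed

text \<open>Exhaustion by intervals. The intervals start so large that they meet both sets, since the
  bounded inequality fails for an empty set.\<close>

lemma brunn_minkowski_real:
  fixes A B C :: "real set"
  assumes [measurable]: "A \<in> sets borel" "B \<in> sets borel" "C \<in> sets borel"
    and ne: "A \<noteq> {}" "B \<noteq> {}"
    and mid: "\<And>a b. a \<in> A \<Longrightarrow> b \<in> B \<Longrightarrow> (a + b) / 2 \<in> C"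
  shows "emeasure lborel A + emeasure lborel B \<le> 2 * emeasure lborel C"
proof -
  obtain a b where ab: "a \<in> A" "b \<in> B" using ne by auto
  define k where "k = nat \<lceil>max \<bar>a\<bar> \<bar>b\<bar>\<rceil>"
  define I where "I n = {- real (n + k) .. real (n + k)}" for n
  have I: "a \<in> I n" "b \<in> I n" "bounded (I n)" "I n \<in> sets borel" for n
    unfolding I_def k_def by (auto; linarith)+
  have lim: "(SUP n. emeasure lborel (S \<inter> I n)) = emeasure lborel S"
    if [measurable]: "S \<in> sets borel" for S
  proof -
    have "(\<Union>n. S \<inter> I n) = S"
    proof -
      have "x \<in> I (nat \<lceil>\<bar>x\<bar>\<rceil>)" for x
        unfolding I_def by (simp; linarith)
      then show ?thesis by auto
    qed
    moreover have "incseq (\<lambda>n. S \<inter> I n)"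
      by (auto simp: incseq_def I_def)
    ultimately show ?thesis
      using SUP_emeasure_incseq[of "\<lambda>n. S \<inter> I n" lborel] I(4) that by (simp add: image_subset_iff)
  qed
  have "emeasure lborel A + emeasure lborel B
      = (SUP n. emeasure lborel (A \<inter> I n) + emeasure lborel (B \<inter> I n))"
    unfolding lim[OF assms(1), symmetric] lim[OF assms(2), symmetric]
    using I(4) by (intro ennreal_SUP_add[symmetric])
      (auto intro!: incseq_SucI emeasure_mono simp: I_def)
  also have "\<dots> \<le> 2 * emeasure lborel C"
  proof (rule SUP_least)
    fix n
    show "emeasure lborel (A \<inter> I n) + emeasure lborel (B \<inter> I n) \<le> 2 * emeasure lborel C"
      using ab I[of n] mid
      by (intro brunn_minkowski_real_bounded) auto
  qed
  finally show ?thesis .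
qed

text \<open>The layer cake formula for the part of \<open>\<phi>\<close> below height \<open>c\<close>, with the heights rescaled to the
  unit interval. The rescaling makes the level sets of functions with different suprema
  comparable at the same parameter \<open>r\<close>.\<close>

lemma nn_integral_min_eq_layers:
  fixes \<phi> :: "real \<Rightarrow> ennreal" and c :: real
  assumes [measurable]: "\<phi> \<in> borel_measurable borel" and c: "0 < c"
  shows "(\<integral>\<^sup>+x. min (\<phi> x) (ennreal c) \<partial>lborel)
    = ennreal c * (\<integral>\<^sup>+r. emeasure lborel {x. ennreal (c * r) < \<phi> x} * indicator {0<..<1} r \<partial>lborel)"
proof -
  have slice: "min (\<phi> x) (ennreal c)
      = ennreal c * (\<integral>\<^sup>+r. indicator {x. ennreal (c * r) < \<phi> x} x * indicator {0<..<1} r \<partial>lborel)" for x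
  proof (cases "\<phi> x")
    case (real p)
    have "(\<integral>\<^sup>+r. indicator {x. ennreal (c * r) < \<phi> x} x * indicator {0<..<1} r \<partial>lborel)
      = (\<integral>\<^sup>+r. indicator {0<..<min (p / c) 1} r \<partial>lborel)"
      using c real by (intro nn_integral_cong)
        (auto split: split_indicator simp: ennreal_less_iff field_simps)
    also have "\<dots> = ennreal (min (p / c) 1)"
      using c real by simp
    finally show ?thesis
      using c real by (simp add: ennreal_mult[symmetric] min_def field_simps)
  next
    case top
    have "(\<integral>\<^sup>+r. indicator {x. ennreal (c * r) < \<phi> x} x * indicator {0<..<1} r \<partial>lborel)
      = (\<integral>\<^sup>+r. indicator {0<..<1::real} r \<partial>lborel)"
      using top by (intro nn_integral_cong) (auto split: split_indicator)
    then show ?thesis using top by simp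
  qed
  have "(\<integral>\<^sup>+x. min (\<phi> x) (ennreal c) \<partial>lborel) = ennreal c *
      (\<integral>\<^sup>+x. (\<integral>\<^sup>+r. indicator {x. ennreal (c * r) < \<phi> x} x * indicator {0<..<1} r \<partial>lborel) \<partial>lborel)"
    unfolding slice by (rule nn_integral_cmult) measurable
  also have "(\<integral>\<^sup>+x. (\<integral>\<^sup>+r. indicator {x. ennreal (c * r) < \<phi> x} x * indicator {0<..<1} r \<partial>lborel) \<partial>lborel)
    = (\<integral>\<^sup>+r. (\<integral>\<^sup>+x. indicator {x. ennreal (c * r) < \<phi> x} x * indicator {0<..<1} r \<partial>lborel) \<partial>lborel)"
    by (rule lborel_pair.Fubini') measurable
  also have "\<dots> = (\<integral>\<^sup>+r. emeasure lborel {x. ennreal (c * r) < \<phi> x} * indicator {0<..<1} r \<partial>lborel)"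
    by (intro nn_integral_cong) (simp add: nn_integral_multc)
  finally show ?thesis .
qed

text \<open>The inequality between the arithmetic and the geometric mean. The square of \<open>P - Q\<close>
  behind it makes sense for finite values only, so infinite ones are split off.\<close>

lemma four_mult_le_sum_power2_ennreal:
  fixes P Q :: ennreal
  shows "4 * (P * Q) \<le> (P + Q)^2"
proof (cases "P = \<infinity> \<or> Q = \<infinity>")
  case True
  then show ?thesis by (auto simp: power2_eq_square)
next
  case False
  then obtain p q where pq: "P = ennreal p" "Q = ennreal q" "0 \<le> p" "0 \<le> q"
    by (metis ennreal_cases infinity_ennreal_def)
  have "4 * (p * q) \<le> (p + q)^2"
    using sum_squares_ge_zero[of "p - q" 0] by (simp add: power2_eq_square algebra_simps)
  then show ?thesis
    using pq by (simp add: ennreal_plus[symmetric] ennreal_mult[symmetric] ennreal_power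
        ennreal_numeral[symmetric] del: ennreal_plus ennreal_numeral)
qed

text \<open>Let \<open>m\<close> and \<open>n\<close> be the suprema of \<open>f\<close> and \<open>g\<close>, and \<open>c = sqrt (m n)\<close>. For \<open>0 < r < 1\<close> the level
  sets \<open>{f > m r}\<close> and \<open>{g > n r}\<close> are nonempty, and their midpoints lie in \<open>{h > c r}\<close>, so the
  Brunn-Minkowski inequality on the line applies. Integrating over \<open>r\<close> bounds the integral of
  \<open>h\<close> below by \<open>c\<close> times an arithmetic mean, hence by a geometric mean.\<close>

lemma prekopa_leindler_real_bounded:
  fixes f g h :: "real \<Rightarrow> ennreal"
  assumes [measurable]: "f \<in> borel_measurable borel" "g \<in> borel_measurable borel" "h \<in> borel_measurable borel"
    and bd: "\<And>x. f x \<le> ennreal M" "\<And>x. g x \<le> ennreal M"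
    and mid: "\<And>a b. f a * g b \<le> (h ((a + b) / 2))^2"
  shows "(\<integral>\<^sup>+x. f x \<partial>lborel) * (\<integral>\<^sup>+x. g x \<partial>lborel) \<le> (\<integral>\<^sup>+x. h x \<partial>lborel)^2"
proof -
  have sup: "\<exists>m\<ge>0. (SUP x. \<phi> x) = ennreal m" if "\<And>x. \<phi> x \<le> ennreal M" for \<phi> :: "real \<Rightarrow> ennreal"
  proof -
    have "(SUP x. \<phi> x) \<le> ennreal M" using that by (rule SUP_least)
    then show ?thesis by (cases "SUP x. \<phi> x") (auto simp: top_unique)
  qed
  obtain m n where m: "0 \<le> m" "(SUP x. f x) = ennreal m" and n: "0 \<le> n" "(SUP x. g x) = ennreal n"
    using sup[of f] sup[of g] bd by metis
  have le: "f x \<le> ennreal m" "g x \<le> ennreal n" for x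
    unfolding m(2)[symmetric] n(2)[symmetric] by (auto intro: SUP_upper)
  show ?thesis
  proof (cases "m = 0 \<or> n = 0")
    case True
    then have "(\<forall>x. f x = 0) \<or> (\<forall>x. g x = 0)" using le by auto
    then show ?thesis by auto
  next
    case False
    then have mn: "0 < m" "0 < n" using m n by auto
    define c where "c = sqrt (m * n)"
    have c: "0 < c" "c^2 = m * n" using mn by (auto simp: c_def)
    define P where "P = (\<integral>\<^sup>+r. emeasure lborel {x. ennreal (m * r) < f x} * indicator {0<..<1} r \<partial>lborel)"
    define Q where "Q = (\<integral>\<^sup>+r. emeasure lborel {x. ennreal (n * r) < g x} * indicator {0<..<1} r \<partial>lborel)"
    define R where "R = (\<integral>\<^sup>+r. emeasure lborel {x. ennreal (c * r) < h x} * indicator {0<..<1} r \<partial>lborel)"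
    have meas: "(\<lambda>r. emeasure lborel {x. ennreal (k * r) < \<phi> x}) \<in> borel_measurable borel"
      if [measurable]: "\<phi> \<in> borel_measurable borel" for k :: real and \<phi> :: "real \<Rightarrow> ennreal"
    proof -
      have "(\<lambda>r. \<integral>\<^sup>+x. indicator {x. ennreal (k * r) < \<phi> x} x \<partial>lborel) \<in> borel_measurable borel"
        by measurable
      then show ?thesis by simp
    qed
    note [measurable] = meas[OF assms(1)] meas[OF assms(2)] meas[OF assms(3)]
    have level: "emeasure lborel {x. ennreal (m * r) < f x} + emeasure lborel {x. ennreal (n * r) < g x}
        \<le> 2 * emeasure lborel {x. ennreal (c * r) < h x}" if r: "0 < r" "r < 1" for r
    proof (rule brunn_minkowski_real)
      have "ennreal (m * r) < (SUP x. f x)" "ennreal (n * r) < (SUP x. g x)"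
        using mn r by (auto simp: m n ennreal_less_iff)
      then show "{x. ennreal (m * r) < f x} \<noteq> {}" "{x. ennreal (n * r) < g x} \<noteq> {}"
        by (auto simp: less_SUP_iff)
      fix a b assume ab: "a \<in> {x. ennreal (m * r) < f x}" "b \<in> {x. ennreal (n * r) < g x}"
      have "(ennreal (c * r))^2 = ennreal (m * r) * ennreal (n * r)"
        using c mn r by (simp add: ennreal_power ennreal_mult[symmetric] power_mult_distrib)
          (simp add: power2_eq_square algebra_simps)
      also have "\<dots> < f a * g b"
      proof -
        have "0 < ennreal (n * r)" using mn r by simp
        then have "ennreal (m * r) * ennreal (n * r) < f a * ennreal (n * r)"
          using ab by (intro ennreal_mult_strict_right_mono) auto
        also have "\<dots> \<le> f a * g b" using ab by (intro mult_left_mono) auto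
        finally show ?thesis .
      qed
      also have "\<dots> \<le> (h ((a + b) / 2))^2" by (rule mid)
      finally have "(ennreal (c * r))^2 < (h ((a + b) / 2))^2" .
      then show "(a + b) / 2 \<in> {x. ennreal (c * r) < h x}"
        using power_mono[of "h ((a + b) / 2)" "ennreal (c * r)" 2] by (auto simp: not_le[symmetric])
    qed measurable
    have "P + Q = (\<integral>\<^sup>+r. (emeasure lborel {x. ennreal (m * r) < f x} + emeasure lborel {x. ennreal (n * r) < g x})
        * indicator {0<..<1} r \<partial>lborel)"
      unfolding P_def Q_def distrib_right by (subst nn_integral_add) auto
    also have "\<dots> \<le> (\<integral>\<^sup>+r. 2 * (emeasure lborel {x. ennreal (c * r) < h x} * indicator {0<..<1} r) \<partial>lborel)"
      using level by (intro nn_integral_mono) (auto split: split_indicator)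
    also have "\<dots> = 2 * R"
      unfolding R_def by (rule nn_integral_cmult) measurable
    finally have PQR: "P + Q \<le> 2 * R" .
    \<comment> \<open>the layers above height \<open>c\<close> are discarded\<close>
    have R: "ennreal c * R \<le> (\<integral>\<^sup>+x. h x \<partial>lborel)"
      unfolding R_def nn_integral_min_eq_layers[OF assms(3) c(1), symmetric]
      by (intro nn_integral_mono) auto
    have "(\<integral>\<^sup>+x. f x \<partial>lborel) = ennreal m * P" "(\<integral>\<^sup>+x. g x \<partial>lborel) = ennreal n * Q"
      unfolding P_def Q_def using le
      by (simp_all add: nn_integral_min_eq_layers[OF assms(1) mn(1), symmetric]
        nn_integral_min_eq_layers[OF assms(2) mn(2), symmetric] min_absorb1)
    then have "4 * ((\<integral>\<^sup>+x. f x \<partial>lborel) * (\<integral>\<^sup>+x. g x \<partial>lborel)) = (ennreal c)^2 * (4 * (P * Q))"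
      using mn c by (simp add: ennreal_power ennreal_mult ac_simps)
    also have "\<dots> \<le> (ennreal c)^2 * (P + Q)^2"
      by (intro mult_left_mono four_mult_le_sum_power2_ennreal) auto
    also have "\<dots> \<le> (ennreal c)^2 * (2 * R)^2"
      using PQR by (intro mult_left_mono power_mono) auto
    also have "\<dots> = 4 * (ennreal c * R)^2"
      by (simp add: power_mult_distrib ac_simps)
    also have "\<dots> \<le> 4 * (\<integral>\<^sup>+x. h x \<partial>lborel)^2"
      using R by (intro mult_left_mono power_mono) auto
    finally show ?thesis
      by (subst (asm) ennreal_mult_le_mult_iff) auto
  qed
qed

lemma nn_integral_SUP_truncate:
  fixes f :: "'a \<Rightarrow> ennreal"
  assumes [measurable]: "f \<in> borel_measurable M"
  shows "(SUP k. \<integral>\<^sup>+x. min (f x) (ennreal (real k)) \<partial>M) = (\<integral>\<^sup>+x. f x \<partial>M)"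
proof -
  have "(SUP k. min (f x) (ennreal (real k))) = f x" for x
  proof -
    have "(SUP k. inf (f x) (of_nat k)) = inf (f x) (SUP k. of_nat k)"
      by (rule inf_SUP[symmetric])
    then show ?thesis
      by (simp add: ennreal_SUP_of_nat_eq_top inf_min ennreal_of_nat_eq_real_of_nat[symmetric])
  qed
  moreover have "incseq (\<lambda>k x. min (f x) (ennreal (real k)))"
    by (auto simp: incseq_def le_fun_def intro: ennreal_leI min.coboundedI2)
  ultimately show ?thesis
    by (subst nn_integral_monotone_convergence_SUP[symmetric]) auto
qed

text \<open>Truncating \<open>f\<close> and \<open>g\<close> preserves the hypothesis, and the integrals converge monotonically.\<close>

lemma prekopa_leindler_real:
  fixes f g h :: "real \<Rightarrow> ennreal"
  assumes [measurable]: "f \<in> borel_measurable borel" "g \<in> borel_measurable borel" "h \<in> borel_measurable borel"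
    and mid: "\<And>a b. f a * g b \<le> (h ((a + b) / 2))^2"
  shows "(\<integral>\<^sup>+x. f x \<partial>lborel) * (\<integral>\<^sup>+x. g x \<partial>lborel) \<le> (\<integral>\<^sup>+x. h x \<partial>lborel)^2"
proof -
  have "(\<integral>\<^sup>+x. min (f x) (ennreal (real j)) \<partial>lborel) * (\<integral>\<^sup>+x. min (g x) (ennreal (real k)) \<partial>lborel)
      \<le> (\<integral>\<^sup>+x. h x \<partial>lborel)^2" for j k
  proof (rule prekopa_leindler_real_bounded)
    fix a b
    show "min (f a) (ennreal (real j)) * min (g b) (ennreal (real k)) \<le> (h ((a + b) / 2))^2"
      by (rule order_trans[OF mult_mono mid]) auto
    show "min (f a) (ennreal (real j)) \<le> ennreal (real (max j k))" "min (g a) (ennreal (real k)) \<le> ennreal (real (max j k))"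
      by (auto intro!: min.coboundedI2 ennreal_leI)
  qed measurable
  then have "(SUP j. SUP k. (\<integral>\<^sup>+x. min (f x) (ennreal (real j)) \<partial>lborel) * (\<integral>\<^sup>+x. min (g x) (ennreal (real k)) \<partial>lborel))
      \<le> (\<integral>\<^sup>+x. h x \<partial>lborel)^2"
    by (intro SUP_least)
  then show ?thesis
    unfolding SUP_mult_left_ennreal[symmetric] SUP_mult_right_ennreal[symmetric]
    by (simp add: nn_integral_SUP_truncate)
qed

text \<open>The logarithmic change of variables turns the geometric mean of points of the half-line into
  the midpoint of points of the line.\<close>

lemma nn_integral_exp_substitution:
  fixes F :: "real \<Rightarrow> ennreal"
  assumes [measurable]: "F \<in> borel_measurable borel"
  shows "(\<integral>\<^sup>+s. F s * indicator {0<..} s \<partial>lborel) = (\<integral>\<^sup>+a. F (exp a) * ennreal (exp a) \<partial>lborel)"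
proof -
  have "(\<integral>\<^sup>+s. F s * indicator {0<..} s \<partial>lborel)
      = (\<integral>\<^sup>+s. (SUP n. F s * indicator {exp (- real (Suc n))..exp (real (Suc n))} s) \<partial>lborel)"
  proof (intro nn_integral_cong)
    fix s :: real
    show "F s * indicator {0<..} s = (SUP n. F s * indicator {exp (- real (Suc n))..exp (real (Suc n))} s)"
    proof (cases "0 < s")
      case True
      obtain n where n: "\<bar>ln s\<bar> \<le> real n" using real_arch_simple by blast
      then have "exp (- real (Suc n)) \<le> exp (ln s)" "exp (ln s) \<le> exp (real (Suc n))" by auto
      then have "s \<in> {exp (- real (Suc n))..exp (real (Suc n))}" using True by simp
      then show ?thesis using True
        by (intro antisym SUP_upper2[of n] SUP_least) (auto split: split_indicator)
    next
      case False
      have "exp (- real (Suc n)) > s" for n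
        using False exp_gt_zero[of "- real (Suc n)"] by linarith
      then show ?thesis using False by (simp add: not_le)
    qed
  qed
  also have "\<dots> = (SUP n. \<integral>\<^sup>+s. F s * indicator {exp (- real (Suc n))..exp (real (Suc n))} s \<partial>lborel)"
  proof (rule nn_integral_monotone_convergence_SUP)
    have "{exp (- real (Suc m))..exp (real (Suc m))} \<subseteq> {exp (- real (Suc n))..exp (real (Suc n))}" if "m \<le> n" for m n
      using that by (simp add: atLeastatMost_subset_iff)
    then show "incseq (\<lambda>n s. F s * indicator {exp (- real (Suc n))..exp (real (Suc n))} s)"
      unfolding incseq_def le_fun_def
      by (intro allI impI mult_left_mono indicator_leI) (blast, simp)
  qed measurable
  also have "\<dots> = (SUP n. \<integral>\<^sup>+a. F (exp a) * ennreal (exp a) * indicator {- real (Suc n)..real (Suc n)} a \<partial>lborel)"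
    by (intro SUP_cong refl nn_integral_substitution_aux)
      (auto intro!: derivative_eq_intros continuous_intros)
  also have "\<dots> = (\<integral>\<^sup>+a. (SUP n. F (exp a) * ennreal (exp a) * indicator {- real (Suc n)..real (Suc n)} a) \<partial>lborel)"
  proof (rule nn_integral_monotone_convergence_SUP[symmetric])
    show "incseq (\<lambda>n a. F (exp a) * ennreal (exp a) * indicator {- real (Suc n)..real (Suc n)} a)"
      unfolding incseq_def le_fun_def
      by (intro allI impI mult_left_mono indicator_leI) auto
  qed measurable
  also have "\<dots> = (\<integral>\<^sup>+a. F (exp a) * ennreal (exp a) \<partial>lborel)"
  proof (intro nn_integral_cong)
    fix a :: real
    obtain n where n: "\<bar>a\<bar> \<le> real n" using real_arch_simple by blast
    then show "(SUP n. F (exp a) * ennreal (exp a) * indicator {- real (Suc n)..real (Suc n)} a) = F (exp a) * ennreal (exp a)"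
      by (intro antisym SUP_upper2[of n] SUP_least) (auto split: split_indicator)
  qed
  finally show ?thesis .
qed

text \<open>The substitution \<open>s = exp a\<close> contributes the density \<open>exp a\<close>, which is multiplicative, so the
  hypothesis survives with the densities absorbed into the three functions.\<close>

lemma prekopa_leindler_geometric_mean:
  fixes F G H :: "real \<Rightarrow> ennreal"
  assumes [measurable]: "F \<in> borel_measurable borel" "G \<in> borel_measurable borel" "H \<in> borel_measurable borel"
    and mid: "\<And>s t. 0 < s \<Longrightarrow> 0 < t \<Longrightarrow> F s * G t \<le> (H (sqrt (s * t)))^2"
  shows "(\<integral>\<^sup>+s. F s * indicator {0<..} s \<partial>lborel) * (\<integral>\<^sup>+s. G s * indicator {0<..} s \<partial>lborel)
    \<le> (\<integral>\<^sup>+s. H s * indicator {0<..} s \<partial>lborel)^2"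
  unfolding assms(1-3)[THEN nn_integral_exp_substitution]
proof (rule prekopa_leindler_real)
  fix a b :: real
  have e: "sqrt (exp a * exp b) = exp ((a + b) / 2)"
    by (rule real_sqrt_unique) (auto simp: exp_add[symmetric] power2_eq_square)
  have "F (exp a) * ennreal (exp a) * (G (exp b) * ennreal (exp b))
      = (F (exp a) * G (exp b)) * ennreal (exp a * exp b)"
    by (simp add: ennreal_mult ac_simps)
  also have "\<dots> \<le> (H (sqrt (exp a * exp b)))^2 * ennreal (exp a * exp b)"
    by (intro mult_right_mono mid) auto
  also have "exp a * exp b = (exp ((a + b) / 2))^2"
    by (simp add: exp_add[symmetric] power2_eq_square)
  also have "sqrt ((exp ((a + b) / 2))\<^sup>2) = exp ((a + b) / 2)" by simp
  finally show "F (exp a) * ennreal (exp a) * (G (exp b) * ennreal (exp b))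
      \<le> (H (exp ((a + b) / 2)) * ennreal (exp ((a + b) / 2)))^2"
    by (simp add: power_mult_distrib ennreal_power)
qed measurable

lemma nn_integral_even:
  fixes F :: "real \<Rightarrow> ennreal"
  assumes [measurable]: "F \<in> borel_measurable borel" and even: "\<And>s. F (- s) = F s"
  shows "(\<integral>\<^sup>+s. F s \<partial>lborel) = 2 * (\<integral>\<^sup>+s. F s * indicator {0<..} s \<partial>lborel)"
proof -
  have "(\<integral>\<^sup>+s. F s \<partial>lborel) = (\<integral>\<^sup>+s. F s * indicator {0<..} s + F s * indicator {..<0} s \<partial>lborel)"
  proof (rule nn_integral_cong_AE)
    have "AE s in lborel. s \<noteq> (0::real)" by (rule AE_lborel_singleton)
    then show "AE s in lborel. F s = F s * indicator {0<..} s + F s * indicator {..<0} s"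
      by eventually_elim (auto split: split_indicator)
  qed
  also have "\<dots> = (\<integral>\<^sup>+s. F s * indicator {0<..} s \<partial>lborel) + (\<integral>\<^sup>+s. F s * indicator {..<0} s \<partial>lborel)"
    by (rule nn_integral_add) measurable
  also have "(\<integral>\<^sup>+s. F s * indicator {..<0} s \<partial>lborel) = (\<integral>\<^sup>+s. F s * indicator {0<..} s \<partial>lborel)"
    by (subst nn_integral_real_affine[where t = 0 and c = "-1"])
      (auto simp: even intro!: nn_integral_cong split: split_indicator)
  finally show ?thesis by (simp add: mult_2)
qed


section \<open>Slices of product Lebesgue measure and the multiplicative Brunn-Minkowski inequality\<close>

text \<open>Lebesgue measure in coordinates indexed by a finite set. An induction on the dimension is
  possible here because the dimension is a set and not a type. Points are functions that are
  \<open>undefined\<close> outside the index set, as usual for product measures.\<close>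

abbreviation lborel_coord :: "'i set \<Rightarrow> ('i \<Rightarrow> real) measure" where
  "lborel_coord I \<equiv> Pi\<^sub>M I (\<lambda>_. lborel)"

abbreviation slice :: "'i set \<Rightarrow> 'i \<Rightarrow> ('i \<Rightarrow> real) set \<Rightarrow> real \<Rightarrow> ('i \<Rightarrow> real) set" where
  "slice I i A s \<equiv> {x \<in> Pi\<^sub>E I (\<lambda>_. UNIV). x(i := s) \<in> A}"

abbreviation negate :: "'i set \<Rightarrow> ('i \<Rightarrow> real) \<Rightarrow> 'i \<Rightarrow> real" where
  "negate I x \<equiv> (\<lambda>i\<in>I. - x i)"

lemma slice_eq_vimage: "slice I i A s = (\<lambda>x. x(i := s)) -` A \<inter> space (lborel_coord I)"
  by (auto simp: space_PiM)

lemma measurable_fun_upd_lborel_coord: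
  "(\<lambda>x. x(i := s)) \<in> lborel_coord I \<rightarrow>\<^sub>M lborel_coord (insert i I)"
proof -
  have "(\<lambda>p. (fst p)(i := snd p)) \<in> lborel_coord I \<Otimes>\<^sub>M lborel \<rightarrow>\<^sub>M lborel_coord (insert i I)"
    using measurable_add_dim[of i I "\<lambda>_. lborel"] by (simp add: case_prod_beta')
  from measurable_compose[OF _ this, of "\<lambda>x. (x, s)" "lborel_coord I"] show ?thesis by simp
qed

lemma sets_slice:
  assumes "A \<in> sets (lborel_coord (insert i I))"
  shows "slice I i A s \<in> sets (lborel_coord I)"
  unfolding slice_eq_vimage by (rule measurable_sets[OF measurable_fun_upd_lborel_coord assms])

lemma sets_fibre:
  assumes "A \<in> sets (lborel_coord (insert i I))" "x \<in> Pi\<^sub>E I (\<lambda>_. UNIV)"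
  shows "{s. x(i := s) \<in> A} \<in> sets borel"
proof -
  have "(\<lambda>s. x(i := s)) \<in> lborel \<rightarrow>\<^sub>M lborel_coord (insert i I)"
    using measurable_compose[OF _ measurable_add_dim[of i I "\<lambda>_. lborel"], of "\<lambda>s. (x, s)" lborel] assms(2)
    by (simp add: space_PiM)
  from measurable_sets[OF this assms(1)] show ?thesis by (simp add: vimage_def)
qed

lemma
  assumes I: "finite I" "i \<notin> I" and A: "A \<in> sets (lborel_coord (insert i I))"
  shows emeasure_eq_slices:
      "emeasure (lborel_coord (insert i I)) A = (\<integral>\<^sup>+s. emeasure (lborel_coord I) (slice I i A s) \<partial>lborel)"
    and measurable_emeasure_slice:
      "(\<lambda>s. emeasure (lborel_coord I) (slice I i A s)) \<in> borel_measurable borel"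
    and emeasure_eq_fibres:
      "emeasure (lborel_coord (insert i I)) A = (\<integral>\<^sup>+x. emeasure lborel {s. x(i := s) \<in> A} \<partial>lborel_coord I)"
proof -
  interpret product_sigma_finite "\<lambda>_::'a. lborel :: real measure" ..
  interpret S: sigma_finite_measure "lborel_coord I" by (rule sigma_finite[OF I(1)])
  have ind: "(indicator A :: _ \<Rightarrow> ennreal) \<in> borel_measurable (lborel_coord (insert i I))"
    using A by simp
  have slice: "emeasure (lborel_coord I) (slice I i A s) = (\<integral>\<^sup>+x. indicator A (x(i := s)) \<partial>lborel_coord I)" for s
    unfolding nn_integral_indicator[OF sets_slice[OF A], symmetric]
    by (intro nn_integral_cong) (auto simp: space_PiM split: split_indicator)
  show "emeasure (lborel_coord (insert i I)) A = (\<integral>\<^sup>+s. emeasure (lborel_coord I) (slice I i A s) \<partial>lborel)"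
    unfolding slice product_nn_integral_insert_rev[OF I ind, symmetric] using A by simp
  have "(\<lambda>(s, x). x(i := s)) \<in> borel \<Otimes>\<^sub>M lborel_coord I \<rightarrow>\<^sub>M lborel_coord (insert i I)"
  proof -
    have "(\<lambda>p. (snd p, fst p)) \<in> borel \<Otimes>\<^sub>M lborel_coord I \<rightarrow>\<^sub>M lborel_coord I \<Otimes>\<^sub>M lborel"
      by measurable
    from measurable_compose[OF this measurable_add_dim[of i I "\<lambda>_. lborel"]] show ?thesis
      by (simp add: case_prod_beta')
  qed
  from measurable_compose[OF this ind]
  show "(\<lambda>s. emeasure (lborel_coord I) (slice I i A s)) \<in> borel_measurable borel"
    unfolding slice by (intro S.borel_measurable_nn_integral) (simp add: case_prod_beta')
  have "emeasure (lborel_coord (insert i I)) A = (\<integral>\<^sup>+x. (\<integral>\<^sup>+s. indicator A (x(i := s)) \<partial>lborel) \<partial>lborel_coord I)"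
    unfolding product_nn_integral_insert[OF I ind, symmetric] using A by simp
  also have "\<dots> = (\<integral>\<^sup>+x. emeasure lborel {s. x(i := s) \<in> A} \<partial>lborel_coord I)"
  proof (intro nn_integral_cong)
    fix x assume "x \<in> space (lborel_coord I)"
    then have [measurable]: "{s. x(i := s) \<in> A} \<in> sets borel"
      by (intro sets_fibre[OF A]) (simp add: space_PiM)
    have "(\<integral>\<^sup>+s. indicator A (x(i := s)) \<partial>lborel) = (\<integral>\<^sup>+s. indicator {s. x(i := s) \<in> A} s \<partial>lborel)"
      by (intro nn_integral_cong) (auto split: split_indicator)
    then show "(\<integral>\<^sup>+s. indicator A (x(i := s)) \<partial>lborel) = emeasure lborel {s. x(i := s) \<in> A}"
      by simp
  qed
  finally show "emeasure (lborel_coord (insert i I)) A = (\<integral>\<^sup>+x. emeasure lborel {s. x(i := s) \<in> A} \<partial>lborel_coord I)" .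
qed

lemma emeasure_lborel_uminus_vimage:
  fixes A :: "real set"
  assumes [measurable]: "A \<in> sets borel"
  shows "emeasure lborel (uminus -` A) = emeasure lborel A"
proof -
  have [measurable]: "uminus -` A \<in> sets borel"
    by (rule measurable_sets_borel[of _ borel]) auto
  have "emeasure lborel (uminus -` A) = (\<integral>\<^sup>+x. indicator (uminus -` A) x \<partial>lborel)" by simp
  also have "\<dots> = (\<integral>\<^sup>+x. indicator A (- x) \<partial>lborel)"
    by (intro nn_integral_cong) (auto split: split_indicator)
  also have "\<dots> = (\<integral>\<^sup>+x. indicator A x \<partial>lborel)"
    by (subst (2) nn_integral_real_affine[where t = 0 and c = "-1"]) auto
  finally show ?thesis by simp
qed

lemma measurable_negate: "negate I \<in> lborel_coord I \<rightarrow>\<^sub>M lborel_coord I"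
  by (rule measurable_restrict) measurable

lemma
  assumes I: "finite I" and A: "A \<in> sets (lborel_coord I)"
  shows sets_negate: "{x \<in> Pi\<^sub>E I (\<lambda>_. UNIV). negate I x \<in> A} \<in> sets (lborel_coord I)"
    and emeasure_negate: "emeasure (lborel_coord I) {x \<in> Pi\<^sub>E I (\<lambda>_. UNIV). negate I x \<in> A} = emeasure (lborel_coord I) A"
proof -
  interpret product_sigma_finite "\<lambda>_::'a. lborel :: real measure" ..
  have eq: "{x \<in> Pi\<^sub>E I (\<lambda>_. UNIV). negate I x \<in> S} = negate I -` S \<inter> space (lborel_coord I)" for S
    by (auto simp: space_PiM)
  show "{x \<in> Pi\<^sub>E I (\<lambda>_. UNIV). negate I x \<in> A} \<in> sets (lborel_coord I)"
    unfolding eq by (rule measurable_sets[OF measurable_negate A])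
  have "distr (lborel_coord I) (lborel_coord I) (negate I) = lborel_coord I"
  proof (rule PiM_eqI[OF I])
    fix B :: "'a \<Rightarrow> real set" assume B: "\<And>i. i \<in> I \<Longrightarrow> B i \<in> sets lborel"
    have "emeasure (distr (lborel_coord I) (lborel_coord I) (negate I)) (Pi\<^sub>E I B)
        = emeasure (lborel_coord I) (negate I -` Pi\<^sub>E I B \<inter> space (lborel_coord I))"
      using B I by (intro emeasure_distr measurable_negate sets_PiM_I_finite) auto
    also have "negate I -` Pi\<^sub>E I B \<inter> space (lborel_coord I) = Pi\<^sub>E I (\<lambda>i. uminus -` B i)"
      by (auto simp: space_PiM PiE_iff)
    also have "emeasure (lborel_coord I) \<dots> = (\<Prod>i\<in>I. emeasure lborel (uminus -` B i))"
      using B I by (intro emeasure_PiM) (auto intro: measurable_sets_borel[of _ borel])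
    also have "\<dots> = (\<Prod>i\<in>I. emeasure lborel (B i))"
      using B by (intro prod.cong refl emeasure_lborel_uminus_vimage) auto
    finally show "emeasure (distr (lborel_coord I) (lborel_coord I) (negate I)) (Pi\<^sub>E I B)
      = (\<Prod>i\<in>I. emeasure lborel (B i))" .
  qed simp
  then have "emeasure (lborel_coord I) A = emeasure (distr (lborel_coord I) (lborel_coord I) (negate I)) A"
    by simp
  also have "\<dots> = emeasure (lborel_coord I) {x \<in> Pi\<^sub>E I (\<lambda>_. UNIV). negate I x \<in> A}"
    unfolding eq by (rule emeasure_distr[OF measurable_negate A])
  finally show "emeasure (lborel_coord I) {x \<in> Pi\<^sub>E I (\<lambda>_. UNIV). negate I x \<in> A} = emeasure (lborel_coord I) A" ..
qed

lemma emeasure_lborel_coord_empty: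
  assumes "A \<subseteq> Pi\<^sub>E {} (\<lambda>_. UNIV)"
  shows "emeasure (lborel_coord {}) A = (if A = {} then 0 else 1)"
proof -
  have "A = {} \<or> A = {\<lambda>_. undefined}" using assms by auto
  then show ?thesis by (auto simp: PiM_empty)
qed

text \<open>Induction on the dimension: midpoints of a slice of \<open>A\<close> and a slice of \<open>B\<close> lie in the slice of
  \<open>C\<close> at the midpoint height. The induction hypothesis for these slices is exactly the hypothesis
  of the Prekopa-Leindler inequality for the volumes of the slices as functions of the height.\<close>

theorem brunn_minkowski_midpoint:
  assumes "finite I"
    and "A \<in> sets (lborel_coord I)" "B \<in> sets (lborel_coord I)" "C \<in> sets (lborel_coord I)"
    and "\<And>x y. x \<in> A \<Longrightarrow> y \<in> B \<Longrightarrow> (\<lambda>i\<in>I. (x i + y i) / 2) \<in> C"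
  shows "emeasure (lborel_coord I) A * emeasure (lborel_coord I) B \<le> (emeasure (lborel_coord I) C)^2"
  using assms
proof (induction I arbitrary: A B C rule: finite_induct)
  case empty
  have "A \<subseteq> Pi\<^sub>E {} (\<lambda>_. UNIV)" "B \<subseteq> Pi\<^sub>E {} (\<lambda>_. UNIV)" "C \<subseteq> Pi\<^sub>E {} (\<lambda>_. UNIV)"
    using empty.prems(1-3)[THEN sets.sets_into_space] by (simp_all add: space_PiM)
  then show ?case
    using empty.prems(4) by (auto simp: emeasure_lborel_coord_empty)
next
  case (insert i I)
  note meas = measurable_emeasure_slice[OF insert.hyps]
  show ?case
    unfolding insert.prems(1-3)[THEN emeasure_eq_slices[OF insert.hyps]]
  proof (rule prekopa_leindler_real)
    fix s t
    show "emeasure (lborel_coord I) (slice I i A s) * emeasure (lborel_coord I) (slice I i B t)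
        \<le> (emeasure (lborel_coord I) (slice I i C ((s + t) / 2)))^2"
    proof (intro insert.IH sets_slice insert.prems(1-3))
      fix x y assume "x \<in> slice I i A s" "y \<in> slice I i B t"
      then have "x(i := s) \<in> A" "y(i := t) \<in> B" by auto
      then have "(\<lambda>j\<in>insert i I. ((x(i := s)) j + (y(i := t)) j) / 2) \<in> C"
        by (rule insert.prems(4))
      also have "(\<lambda>j\<in>insert i I. ((x(i := s)) j + (y(i := t)) j) / 2)
          = (\<lambda>j\<in>I. (x j + y j) / 2)(i := (s + t) / 2)"
        using insert.hyps by (auto simp: fun_eq_iff)
      finally show "(\<lambda>j\<in>I. (x j + y j) / 2) \<in> slice I i C ((s + t) / 2)"
        by (simp del: fun_upd_apply)
    qed
  qed (intro meas insert.prems)+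
qed


section \<open>Steiner symmetrization along a coordinate\<close>

text \<open>Openness in the coordinates of \<open>I\<close>. The product topology on all functions cannot be used: its
  open sets restrict only finitely many coordinates, whereas the points considered here are fixed
  outside \<open>I\<close>.\<close>

definition coord_open :: "'i set \<Rightarrow> ('i \<Rightarrow> real) set \<Rightarrow> bool" where
  "coord_open I A \<longleftrightarrow> A \<subseteq> Pi\<^sub>E I (\<lambda>_. UNIV) \<and>
     (\<forall>x\<in>A. \<exists>e>0. \<forall>y\<in>Pi\<^sub>E I (\<lambda>_. UNIV). (\<forall>i\<in>I. \<bar>y i - x i\<bar> < e) \<longrightarrow> y \<in> A)"

abbreviation coord_cball :: "'i set \<Rightarrow> real \<Rightarrow> ('i \<Rightarrow> real) set" where
  "coord_cball I c \<equiv> {x \<in> Pi\<^sub>E I (\<lambda>_. UNIV). (\<Sum>i\<in>I. x i * x i) \<le> c}"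

lemma coord_openD:
  assumes "coord_open I A" "x \<in> A"
  obtains e where "0 < e" "\<And>y. y \<in> Pi\<^sub>E I (\<lambda>_. UNIV) \<Longrightarrow> (\<And>i. i \<in> I \<Longrightarrow> \<bar>y i - x i\<bar> < e) \<Longrightarrow> y \<in> A"
  using assms unfolding coord_open_def by meson

text \<open>Such a set is the union of the countably many cubes with rational centre and rational size
  that it contains.\<close>

lemma sets_coord_open:
  assumes I: "finite I" and A: "coord_open I A"
  shows "A \<in> sets (lborel_coord I)"
proof -
  define Q where "Q = Pi\<^sub>E I (\<lambda>_. \<rat> :: real set) \<times> (\<rat> :: real set)"
  define cube where "cube p = Pi\<^sub>E I (\<lambda>i. {fst p i - snd p <..< fst p i + snd p})" for p :: "('a \<Rightarrow> real) \<times> real"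
  define P where "P = {p \<in> Q. cube p \<subseteq> A}"
  have "countable Q"
    unfolding Q_def using I by (intro countable_SIGMA countable_PiE countable_rat)
  then have "countable P" by (rule countable_subset[rotated]) (auto simp: P_def)
  moreover have "cube p \<in> sets (lborel_coord I)" for p
    unfolding cube_def using I by (intro sets_PiM_I_finite) auto
  ultimately have "(\<Union>p\<in>P. cube p) \<in> sets (lborel_coord I)"
    by (intro sets.countable_UN') auto
  moreover have "(\<Union>p\<in>P. cube p) = A"
  proof
    show "(\<Union>p\<in>P. cube p) \<subseteq> A" by (auto simp: P_def)
    show "A \<subseteq> (\<Union>p\<in>P. cube p)"
    proof
      fix x assume x: "x \<in> A"
      have xE: "x \<in> Pi\<^sub>E I (\<lambda>_. UNIV)" using A x by (auto simp: coord_open_def)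
      obtain e where e: "0 < e" "\<And>y. y \<in> Pi\<^sub>E I (\<lambda>_. UNIV) \<Longrightarrow> (\<And>i. i \<in> I \<Longrightarrow> \<bar>y i - x i\<bar> < e) \<Longrightarrow> y \<in> A"
        using coord_openD[OF A x] by blast
      obtain d where d: "d \<in> \<rat>" "0 < d" "d < e / 2"
        using Rats_dense_in_real[of 0 "e / 2"] e by auto
      have "\<exists>q. q \<in> \<rat> \<and> \<bar>q - x i\<bar> < d" for i
      proof -
        obtain q where "q \<in> \<rat>" "x i - d < q" "q < x i + d"
          using Rats_dense_in_real[of "x i - d" "x i + d"] d by auto
        then show ?thesis by (intro exI[of _ q]) (simp add: abs_less_iff)
      qed
      then obtain q where q: "\<And>i. q i \<in> \<rat>" "\<And>i. \<bar>q i - x i\<bar> < d" by metis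
      define p where "p = (restrict q I, d)"
      have "p \<in> P"
      proof -
        have "cube p \<subseteq> A"
        proof
          fix y assume y: "y \<in> cube p"
          show "y \<in> A"
          proof (rule e(2))
            show "y \<in> Pi\<^sub>E I (\<lambda>_. UNIV)" using y by (auto simp: cube_def PiE_iff)
            fix i assume "i \<in> I"
            then have "\<bar>y i - q i\<bar> < d" using y by (auto simp: cube_def p_def PiE_iff)
            then show "\<bar>y i - x i\<bar> < e" using q(2)[of i] d by linarith
          qed
        qed
        then show ?thesis using d q by (auto simp: P_def Q_def p_def)
      qed
      moreover have "x \<in> cube p"
      proof -
        have "q i - d < x i \<and> x i < q i + d" for i using q(2)[of i] by linarith
        then show ?thesis using xE by (auto simp: cube_def p_def PiE_iff)
      qed
      ultimately show "x \<in> (\<Union>p\<in>P. cube p)" by blast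
    qed
  qed
  ultimately show ?thesis by simp
qed

lemma coord_open_slice:
  assumes A: "coord_open (insert i I) A" and i: "i \<notin> I"
  shows "coord_open I (slice I i A s)"
  unfolding coord_open_def
proof (intro conjI ballI)
  fix x assume "x \<in> slice I i A s"
  then have x: "x(i := s) \<in> A" by simp
  obtain e where e: "0 < e" "\<And>y. y \<in> Pi\<^sub>E (insert i I) (\<lambda>_. UNIV) \<Longrightarrow> (\<And>j. j \<in> insert i I \<Longrightarrow> \<bar>y j - (x(i := s)) j\<bar> < e) \<Longrightarrow> y \<in> A"
    using coord_openD[OF A x] by blast
  have "y(i := s) \<in> A" if y: "y \<in> Pi\<^sub>E I (\<lambda>_. UNIV)" "\<forall>j\<in>I. \<bar>y j - x j\<bar> < e" for y
  proof (rule e(2))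
    show "y(i := s) \<in> Pi\<^sub>E (insert i I) (\<lambda>_. UNIV)" using y(1) by (auto simp: PiE_iff extensional_def)
  qed (use y(2) e(1) i in auto)
  then show "\<exists>e>0. \<forall>y\<in>Pi\<^sub>E I (\<lambda>_. UNIV). (\<forall>i\<in>I. \<bar>y i - x i\<bar> < e) \<longrightarrow> y \<in> slice I i A s"
    using e(1) by blast
qed auto

text \<open>The fibres \<open>F\<close> of \<open>K\<close> in direction \<open>i\<close> are replaced by \<open>(F - F) / 2\<close>. If \<open>F\<close> is an interval,
  this is the centred interval of the same length, that is, the Steiner symmetral.\<close>

definition steiner :: "'i set \<Rightarrow> 'i \<Rightarrow> ('i \<Rightarrow> real) set \<Rightarrow> ('i \<Rightarrow> real) set" where
  "steiner I i K = {z \<in> Pi\<^sub>E (insert i I) (\<lambda>_. UNIV). \<exists>a b. z(i := a) \<in> K \<and> z(i := b) \<in> K \<and> z i = (a - b) / 2}"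

text \<open>The slices \<open>A\<close> of \<open>L\<close> at fixed height in direction \<open>i\<close> are replaced by \<open>(A - A) / 2\<close>. This is
  the counterpart of \<open>steiner\<close> on the polar side: the polar of a Steiner symmetral contains
  the set that arises in this way from the polar.\<close>

definition difference_slices :: "'i set \<Rightarrow> 'i \<Rightarrow> ('i \<Rightarrow> real) set \<Rightarrow> ('i \<Rightarrow> real) set" where
  "difference_slices I i L = {z \<in> Pi\<^sub>E (insert i I) (\<lambda>_. UNIV).
     \<exists>x\<in>L. \<exists>y\<in>L. x i = z i \<and> y i = z i \<and> (\<forall>j\<in>I. z j = (x j - y j) / 2)}"

text \<open>If \<open>z\<close> moves to \<open>w\<close>, the two witnesses \<open>a\<close> and \<open>b\<close> move in opposite directions by
  \<open>w i - z i\<close>, so that half their difference follows the coordinate \<open>i\<close>.\<close>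

lemma coord_open_steiner:
  assumes K: "coord_open (insert i I) K" and i: "i \<notin> I"
  shows "coord_open (insert i I) (steiner I i K)"
  unfolding coord_open_def
proof (intro conjI ballI)
  fix z assume "z \<in> steiner I i K"
  then obtain a b where ab: "z(i := a) \<in> K" "z(i := b) \<in> K" "z i = (a - b) / 2"
    by (auto simp: steiner_def)
  obtain e where e: "0 < e" "\<And>y. y \<in> Pi\<^sub>E (insert i I) (\<lambda>_. UNIV) \<Longrightarrow> (\<And>j. j \<in> insert i I \<Longrightarrow> \<bar>y j - (z(i := a)) j\<bar> < e) \<Longrightarrow> y \<in> K"
    using coord_openD[OF K ab(1)] by blast
  obtain d where d: "0 < d" "\<And>y. y \<in> Pi\<^sub>E (insert i I) (\<lambda>_. UNIV) \<Longrightarrow> (\<And>j. j \<in> insert i I \<Longrightarrow> \<bar>y j - (z(i := b)) j\<bar> < d) \<Longrightarrow> y \<in> K"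
    using coord_openD[OF K ab(2)] by blast
  have "w \<in> steiner I i K" if w: "w \<in> Pi\<^sub>E (insert i I) (\<lambda>_. UNIV)" "\<forall>j\<in>insert i I. \<bar>w j - z j\<bar> < min d e" for w
  proof -
    have "w(i := a + (w i - z i)) \<in> K"
      by (rule e(2)) (use w in \<open>auto simp: PiE_iff extensional_def\<close>)
    moreover have "w(i := b - (w i - z i)) \<in> K"
      by (rule d(2)) (use w in \<open>auto simp: PiE_iff extensional_def\<close>)
    moreover have "w i = ((a + (w i - z i)) - (b - (w i - z i))) / 2"
      using ab(3) by (simp add: field_simps)
    ultimately show ?thesis using w(1) unfolding steiner_def by blast
  qed
  then show "\<exists>e>0. \<forall>y\<in>Pi\<^sub>E (insert i I) (\<lambda>_. UNIV). (\<forall>j\<in>insert i I. \<bar>y j - z j\<bar> < e) \<longrightarrow> y \<in> steiner I i K"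
    using d(1) e(1) by (intro exI[of _ "min d e"]) auto
qed (auto simp: steiner_def)

text \<open>If \<open>z\<close> moves to \<open>w\<close>, the two witnesses move by the same amount at height \<open>i\<close> and by opposite
  amounts in the other coordinates.\<close>

lemma coord_open_difference_slices:
  assumes L: "coord_open (insert i I) L" and i: "i \<notin> I"
  shows "coord_open (insert i I) (difference_slices I i L)"
  unfolding coord_open_def
proof (intro conjI ballI)
  fix z assume "z \<in> difference_slices I i L"
  then obtain x y where xy: "x \<in> L" "y \<in> L" "x i = z i" "y i = z i" "\<And>j. j \<in> I \<Longrightarrow> z j = (x j - y j) / 2"
    by (auto simp: difference_slices_def)
  obtain e where e: "0 < e" "\<And>w. w \<in> Pi\<^sub>E (insert i I) (\<lambda>_. UNIV) \<Longrightarrow> (\<And>j. j \<in> insert i I \<Longrightarrow> \<bar>w j - x j\<bar> < e) \<Longrightarrow> w \<in> L"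
    using coord_openD[OF L xy(1)] by blast
  obtain d where d: "0 < d" "\<And>w. w \<in> Pi\<^sub>E (insert i I) (\<lambda>_. UNIV) \<Longrightarrow> (\<And>j. j \<in> insert i I \<Longrightarrow> \<bar>w j - y j\<bar> < d) \<Longrightarrow> w \<in> L"
    using coord_openD[OF L xy(2)] by blast
  have "w \<in> difference_slices I i L" if w: "w \<in> Pi\<^sub>E (insert i I) (\<lambda>_. UNIV)" "\<forall>j\<in>insert i I. \<bar>w j - z j\<bar> < min d e" for w
  proof -
    define x' where "x' = (\<lambda>j\<in>insert i I. x j + (w j - z j))"
    define y' where "y' = (\<lambda>j\<in>insert i I. if j = i then w i else y j - (w j - z j))"
    have "x' \<in> L"
      by (rule e(2)) (use w in \<open>auto simp: x'_def\<close>)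
    moreover have "y' \<in> L"
      by (rule d(2)) (use w xy(4) in \<open>auto simp: y'_def abs_minus_commute\<close>)
    moreover have "x' i = w i" "y' i = w i" "\<forall>j\<in>I. w j = (x' j - y' j) / 2"
      using xy i by (auto simp: x'_def y'_def field_simps)
    ultimately show ?thesis using w(1) unfolding difference_slices_def by blast
  qed
  then show "\<exists>e>0. \<forall>w\<in>Pi\<^sub>E (insert i I) (\<lambda>_. UNIV). (\<forall>j\<in>insert i I. \<bar>w j - z j\<bar> < e) \<longrightarrow> w \<in> difference_slices I i L"
    using d(1) e(1) by (intro exI[of _ "min d e"]) auto
qed (auto simp: difference_slices_def)

lemma power2_le_imp_le_ennreal:
  fixes P Q :: ennreal
  assumes "P^2 \<le> Q^2"
  shows "P \<le> Q"
proof (rule ccontr)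
  assume "\<not> P \<le> Q"
  then have "Q < P" by simp
  show False
  proof (cases "P = \<infinity>")
    case True
    then show ?thesis using assms \<open>Q < P\<close>
      by (simp add: power2_eq_square top_unique ennreal_mult_eq_top_iff)
  next
    case False
    moreover have "Q \<noteq> \<infinity>" using \<open>Q < P\<close> by auto
    ultimately obtain p q where pq: "P = ennreal p" "Q = ennreal q" "0 \<le> p" "0 \<le> q"
      by (cases P; cases Q) auto
    then show ?thesis using assms \<open>Q < P\<close>
      by (simp add: ennreal_power ennreal_less_iff power_mono_iff)
  qed
qed

text \<open>On each fibre \<open>F\<close> the Brunn-Minkowski inequality on the line, applied to \<open>F\<close> and \<open>- F\<close>, shows
  that \<open>(F - F) / 2\<close> is at least as long as \<open>F\<close>.\<close>

lemma emeasure_le_steiner: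
  assumes I: "finite I" "i \<notin> I" and K: "coord_open (insert i I) K"
  shows "emeasure (lborel_coord (insert i I)) K \<le> emeasure (lborel_coord (insert i I)) (steiner I i K)"
proof -
  have sets: "K \<in> sets (lborel_coord (insert i I))" "steiner I i K \<in> sets (lborel_coord (insert i I))"
    using I K by (auto intro!: sets_coord_open coord_open_steiner)
  show ?thesis
    unfolding emeasure_eq_fibres[OF I sets(1)] emeasure_eq_fibres[OF I sets(2)]
  proof (rule nn_integral_mono)
    fix x assume "x \<in> space (lborel_coord I)"
    then have x: "x \<in> Pi\<^sub>E I (\<lambda>_. UNIV)" by (simp add: space_PiM)
    define A where "A = {s. x(i := s) \<in> K}"
    have A: "A \<in> sets borel" unfolding A_def using sets(1) x by (rule sets_fibre)
    show "emeasure lborel A \<le> emeasure lborel {s. x(i := s) \<in> steiner I i K}" (is "_ \<le> emeasure lborel ?C")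
    proof (cases "A = {}")
      case False
      have "emeasure lborel A + emeasure lborel (uminus -` A) \<le> 2 * emeasure lborel ?C"
      proof (rule brunn_minkowski_real)
        show "uminus -` A \<in> sets borel" using A by (auto intro: measurable_sets_borel[of _ borel])
        show "?C \<in> sets borel" using sets(2) x by (rule sets_fibre)
        show "uminus -` A \<noteq> {}" using False by (metis ex_in_conv minus_minus vimageI2)
        fix a b assume ab: "a \<in> A" "b \<in> uminus -` A"
        have "x(i := a) \<in> K" "x(i := - b) \<in> K" using ab by (auto simp: A_def)
        moreover have "x(i := (a + b) / 2) \<in> Pi\<^sub>E (insert i I) (\<lambda>_. UNIV)"
          using x by (auto simp: PiE_iff extensional_def)
        ultimately show "(a + b) / 2 \<in> ?C"
          unfolding steiner_def by (intro CollectI conjI exI[of _ a] exI[of _ "- b"]) auto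
      qed (use A False in auto)
      then have "2 * emeasure lborel A \<le> 2 * emeasure lborel ?C"
        by (simp add: emeasure_lborel_uminus_vimage[OF A] mult_2)
      then show ?thesis by (subst (asm) ennreal_mult_le_mult_iff) auto
    qed simp
  qed
qed

text \<open>The Brunn-Minkowski inequality in one dimension less, applied to a slice \<open>A\<close> and to \<open>- A\<close>, which
  has the same volume.\<close>

lemma emeasure_le_difference_slices:
  assumes I: "finite I" "i \<notin> I" and L: "coord_open (insert i I) L"
  shows "emeasure (lborel_coord (insert i I)) L \<le> emeasure (lborel_coord (insert i I)) (difference_slices I i L)"
proof -
  have sets: "L \<in> sets (lborel_coord (insert i I))" "difference_slices I i L \<in> sets (lborel_coord (insert i I))"
    using I L by (auto intro!: sets_coord_open coord_open_difference_slices)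
  show ?thesis
    unfolding emeasure_eq_slices[OF I sets(1)] emeasure_eq_slices[OF I sets(2)]
  proof (rule nn_integral_mono, rule power2_le_imp_le_ennreal)
    fix t
    have A: "slice I i L t \<in> sets (lborel_coord I)" using sets(1) by (rule sets_slice)
    have "emeasure (lborel_coord I) (slice I i L t) *
        emeasure (lborel_coord I) {x \<in> Pi\<^sub>E I (\<lambda>_. UNIV). negate I x \<in> slice I i L t}
      \<le> (emeasure (lborel_coord I) (slice I i (difference_slices I i L) t))^2"
    proof (intro brunn_minkowski_midpoint I A sets_negate sets_slice sets(2))
      fix x y assume x: "x \<in> slice I i L t" and y: "y \<in> {x \<in> Pi\<^sub>E I (\<lambda>_. UNIV). negate I x \<in> slice I i L t}"
      have "x(i := t) \<in> L" "(negate I y)(i := t) \<in> L" using x y by auto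
      moreover have "\<forall>j\<in>I. ((\<lambda>j\<in>I. (x j + y j) / 2)(i := t)) j = ((x(i := t)) j - ((negate I y)(i := t)) j) / 2"
        using I(2) by auto
      moreover have "(\<lambda>j\<in>I. (x j + y j) / 2)(i := t) \<in> Pi\<^sub>E (insert i I) (\<lambda>_. UNIV)"
        by (auto simp: PiE_iff extensional_def)
      ultimately have "(\<lambda>j\<in>I. (x j + y j) / 2)(i := t) \<in> difference_slices I i L"
        unfolding difference_slices_def by (intro CollectI conjI bexI[of _ "x(i := t)"] bexI[of _ "(negate I y)(i := t)"]) auto
      then show "(\<lambda>j\<in>I. (x j + y j) / 2) \<in> slice I i (difference_slices I i L) t" by simp
    qed
    then show "(emeasure (lborel_coord I) (slice I i L t))^2
      \<le> (emeasure (lborel_coord I) (slice I i (difference_slices I i L) t))^2"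
      by (simp only: emeasure_negate[OF I(1) A] power2_eq_square)
  qed
qed


section \<open>The Blaschke-Santalo inequality for symmetric open sets\<close>

lemma sets_coord_cball: "finite I \<Longrightarrow> coord_cball I c \<in> sets (lborel_coord I)"
proof -
  assume "finite I"
  have "(\<lambda>x. \<Sum>i\<in>I. x i * x i) \<in> borel_measurable (lborel_coord I)" by measurable
  then have "{x \<in> space (lborel_coord I). (\<Sum>i\<in>I. x i * x i) \<le> c} \<in> sets (lborel_coord I)" by measurable
  then show ?thesis by (simp add: space_PiM)
qed

lemma sum_insert_upd:
  assumes "finite I" "i \<notin> I"
  shows "(\<Sum>j\<in>insert i I. (x(i := s)) j * (y(i := t)) j) = s * t + (\<Sum>j\<in>I. x j * y j :: real)"
proof -
  have "(\<Sum>j\<in>I. (x(i := s)) j * (y(i := t)) j) = (\<Sum>j\<in>I. x j * y j)"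
    using assms by (intro sum.cong) auto
  then show ?thesis using assms by simp
qed

lemma emeasure_even_eq_half_slices:
  assumes I: "finite I" "i \<notin> I" and A: "A \<in> sets (lborel_coord (insert i I))"
    and even: "\<And>s. slice I i A (- s) = slice I i A s"
  shows "emeasure (lborel_coord (insert i I)) A
    = 2 * (\<integral>\<^sup>+s. emeasure (lborel_coord I) (slice I i A s) * indicator {0<..} s \<partial>lborel)"
  unfolding emeasure_eq_slices[OF I A]
  by (intro nn_integral_even measurable_emeasure_slice I A) (simp only: even)

lemma steiner_slice_iff:
  assumes "i \<notin> I" "K \<subseteq> Pi\<^sub>E (insert i I) (\<lambda>_. UNIV)"
  shows "x \<in> slice I i (steiner I i K) s \<longleftrightarrow>
    x \<in> Pi\<^sub>E I (\<lambda>_. UNIV) \<and> (\<exists>a b. x(i := a) \<in> K \<and> x(i := b) \<in> K \<and> s = (a - b) / 2)"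
proof -
  have "x(i := s) \<in> Pi\<^sub>E (insert i I) (\<lambda>_. UNIV)" if "x \<in> Pi\<^sub>E I (\<lambda>_. UNIV)"
    using that by (auto simp: PiE_iff extensional_def)
  then show ?thesis by (auto simp: steiner_def simp del: fun_upd_apply) auto
qed

lemma difference_slices_slice_iff:
  assumes i: "i \<notin> I" and L: "L \<subseteq> Pi\<^sub>E (insert i I) (\<lambda>_. UNIV)"
  shows "x \<in> slice I i (difference_slices I i L) t \<longleftrightarrow>
    (\<exists>y z. y \<in> slice I i L t \<and> z \<in> slice I i L t \<and> x = (\<lambda>j\<in>I. (y j - z j) / 2))" (is "?l \<longleftrightarrow> ?r")
proof
  assume l: ?l
  then obtain u v where uv: "u \<in> L" "v \<in> L" "u i = t" "v i = t" "\<And>j. j \<in> I \<Longrightarrow> (x(i := t)) j = (u j - v j) / 2"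
    by (auto simp: difference_slices_def simp del: fun_upd_apply) auto
  have upd: "(restrict w I)(i := t) = w" if "w \<in> L" "w i = t" for w
    using that L i by (fastforce simp: fun_eq_iff PiE_iff extensional_def)
  have "restrict u I \<in> slice I i L t" "restrict v I \<in> slice I i L t"
    using uv upd[of u] upd[of v] by auto
  moreover have "x = (\<lambda>j\<in>I. (restrict u I j - restrict v I j) / 2)"
  proof
    fix j
    show "x j = (\<lambda>j\<in>I. (restrict u I j - restrict v I j) / 2) j"
    proof (cases "j \<in> I")
      case True
      then have "j \<noteq> i" using i by auto
      then show ?thesis using uv(5)[OF True] True by simp
    next
      case False
      then show ?thesis using l by (auto simp: PiE_iff extensional_def)
    qed
  qed
  ultimately show ?r by blast
next
  assume ?r
  then obtain y z where yz: "y(i := t) \<in> L" "z(i := t) \<in> L" "x = (\<lambda>j\<in>I. (y j - z j) / 2)" by auto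
  have "x(i := t) \<in> difference_slices I i L"
    unfolding difference_slices_def
    by (intro CollectI conjI bexI[OF _ yz(1)] bexI[OF _ yz(2)])
      (use i yz(3) in \<open>auto simp: PiE_iff extensional_def\<close>)
  then show ?l using yz(3) by auto
qed

text \<open>The Blaschke-Santalo inequality in coordinates, by induction on the dimension. Let \<open>N\<close> be the
  Steiner symmetral of \<open>K\<close> in the new direction \<open>i\<close> and let \<open>M\<close> consist of the half difference sets
  of the slices of \<open>L\<close>. Both volumes have grown, the slices of \<open>N\<close> and \<open>M\<close> are symmetric within
  the hyperplane, and a point of \<open>N\<close> at height \<open>s\<close> and a point of \<open>M\<close> at height \<open>t\<close> have a reduced
  inner product at most \<open>c - s t\<close>. The induction hypothesis bounds the product of the two slices
  by the square of the volume of a ball of squared radius \<open>c - s t\<close>, and this ball is the slice of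
  the full ball at height \<open>sqrt (s t)\<close>. The Prekopa-Leindler inequality for geometric means
  integrates these bounds to the claim.\<close>

theorem santalo_coord:
  assumes "finite I" "coord_open I K" "coord_open I L"
    and "\<And>x. x \<in> K \<Longrightarrow> negate I x \<in> K" "\<And>y. y \<in> L \<Longrightarrow> negate I y \<in> L"
    and "\<And>x y. x \<in> K \<Longrightarrow> y \<in> L \<Longrightarrow> (\<Sum>i\<in>I. x i * y i) \<le> c"
  shows "emeasure (lborel_coord I) K * emeasure (lborel_coord I) L \<le> (emeasure (lborel_coord I) (coord_cball I c))^2"
  using assms
proof (induction I arbitrary: K L c rule: finite_induct)
  case empty
  then have "K \<subseteq> Pi\<^sub>E {} (\<lambda>_. UNIV)" "L \<subseteq> Pi\<^sub>E {} (\<lambda>_. UNIV)"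
    by (auto simp: coord_open_def)
  \<comment> \<open>the empty sum is \<open>0\<close>, so two points force \<open>0 \<le> c\<close>\<close>
  moreover have "coord_cball {} c \<noteq> {}" if "K \<noteq> {}" "L \<noteq> {}"
    using that empty.prems(5) by force
  moreover have "coord_cball {} c \<subseteq> Pi\<^sub>E {} (\<lambda>_. UNIV)" by auto
  ultimately show ?case by (auto simp: emeasure_lborel_coord_empty)
next
  case (insert i I)
  let ?\<mu> = "emeasure (lborel_coord I)" and ?\<nu> = "emeasure (lborel_coord (insert i I))"
  note I = insert.hyps and K = insert.prems(1) and L = insert.prems(2)
  define N where "N = steiner I i K"
  define M where "M = difference_slices I i L"
  define B where "B = coord_cball (insert i I) c"
  have KL: "K \<subseteq> Pi\<^sub>E (insert i I) (\<lambda>_. UNIV)" "L \<subseteq> Pi\<^sub>E (insert i I) (\<lambda>_. UNIV)"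
    using K L by (auto simp: coord_open_def)
  note N_iff = steiner_slice_iff[OF I(2) KL(1), folded N_def]
    and M_iff = difference_slices_slice_iff[OF I(2) KL(2), folded M_def]
  have opens: "coord_open (insert i I) N" "coord_open (insert i I) M"
    unfolding N_def M_def using I K L by (auto intro: coord_open_steiner coord_open_difference_slices)
  have sets: "N \<in> sets (lborel_coord (insert i I))" "M \<in> sets (lborel_coord (insert i I))"
      "B \<in> sets (lborel_coord (insert i I))"
    unfolding B_def using I opens by (auto intro!: sets_coord_open sets_coord_cball)
  have neg_upd: "negate (insert i I) (x(i := s)) = (negate I x)(i := - s)" for x s
    using I by (auto simp: fun_eq_iff)
  have K_neg: "(negate I x)(i := - s) \<in> K" if "x(i := s) \<in> K" for x s
    using insert.prems(3)[OF that] unfolding neg_upd .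
  have L_neg: "(negate I x)(i := - s) \<in> L" if "x(i := s) \<in> L" for x s
    using insert.prems(4)[OF that] unfolding neg_upd .
  have sliceB: "slice I i B r = coord_cball I (c - r * r)" for r
  proof -
    have "x(i := r) \<in> Pi\<^sub>E (insert i I) (\<lambda>_. UNIV)" if "x \<in> Pi\<^sub>E I (\<lambda>_. UNIV)" for x
      using that by (auto simp: PiE_iff extensional_def)
    then show ?thesis
      unfolding B_def mem_Collect_eq sum_insert_upd[OF I] by (auto simp del: fun_upd_apply)
  qed
  have N_even: "slice I i N (- s) = slice I i N s" for s
  proof -
    have "x \<in> slice I i N (- s)" if "x \<in> slice I i N s" for x s
      using that unfolding N_iff by (metis minus_diff_eq minus_divide_left)
    from this[of _ s] this[of _ "- s"] show ?thesis by auto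
  qed
  have M_even: "slice I i M (- s) = slice I i M s" for s
  proof -
    have "x \<in> slice I i M (- s)" if x: "x \<in> slice I i M s" for x s
    proof -
      obtain y z where yz: "y \<in> slice I i L s" "z \<in> slice I i L s" "x = (\<lambda>j\<in>I. (y j - z j) / 2)"
        using x unfolding M_iff by blast
      have "negate I z \<in> slice I i L (- s)" "negate I y \<in> slice I i L (- s)"
        using yz L_neg by auto
      moreover have "x = (\<lambda>j\<in>I. (negate I z j - negate I y j) / 2)"
        unfolding yz(3) by (auto simp: fun_eq_iff)
      ultimately show ?thesis unfolding M_iff by blast
    qed
    from this[of _ s] this[of _ "- s"] show ?thesis by auto
  qed
  have slices: "?\<mu> (slice I i N s) * ?\<mu> (slice I i M t) \<le> (?\<mu> (slice I i B (sqrt (s * t))))^2"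
    if st: "0 < s" "0 < t" for s t
  proof -
    have "?\<mu> (slice I i N s) * ?\<mu> (slice I i M t) \<le> (?\<mu> (coord_cball I (c - s * t)))^2"
    proof (rule insert.IH)
      show "coord_open I (slice I i N s)" "coord_open I (slice I i M t)"
        using opens I by (auto intro!: coord_open_slice)
    next
      fix x assume "x \<in> slice I i N s"
      then obtain a b where ab: "x(i := a) \<in> K" "x(i := b) \<in> K" "s = (a - b) / 2"
        unfolding N_iff by blast
      have "s = (- b - - a) / 2" using ab(3) by simp
      then show "negate I x \<in> slice I i N s"
        unfolding N_iff using K_neg[OF ab(1)] K_neg[OF ab(2)]
        by (intro conjI exI[of _ "- b"] exI[of _ "- a"]) (simp_all del: fun_upd_apply)
    next
      fix x assume "x \<in> slice I i M t"
      then obtain y z where yz: "y \<in> slice I i L t" "z \<in> slice I i L t" "x = (\<lambda>j\<in>I. (y j - z j) / 2)"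
        unfolding M_iff by blast
      moreover have "negate I x = (\<lambda>j\<in>I. (z j - y j) / 2)"
        unfolding yz(3) by (auto simp: fun_eq_iff diff_divide_distrib)
      ultimately show "negate I x \<in> slice I i M t" unfolding M_iff by blast
    next
      fix x y assume x: "x \<in> slice I i N s" and y: "y \<in> slice I i M t"
      obtain a b where ab: "x(i := a) \<in> K" "x(i := b) \<in> K" "s = (a - b) / 2"
        using x unfolding N_iff by blast
      obtain u v where uv: "u(i := t) \<in> L" "v(i := t) \<in> L" "y = (\<lambda>j\<in>I. (u j - v j) / 2)"
        using y unfolding M_iff by blast
      have 1: "a * t + (\<Sum>j\<in>I. x j * u j) \<le> c"
        using insert.prems(5)[OF ab(1) uv(1)] unfolding sum_insert_upd[OF I] .
      \<comment> \<open>symmetry of \<open>L\<close> moves the second witness to height \<open>- t\<close>, which pairs with \<open>b\<close>\<close>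
      have 2: "b * (- t) + (\<Sum>j\<in>I. x j * negate I v j) \<le> c"
        using insert.prems(5)[OF ab(2) L_neg[OF uv(2)]] unfolding sum_insert_upd[OF I] .
      have "(\<Sum>j\<in>I. x j * negate I v j) = - (\<Sum>j\<in>I. x j * v j)"
        by (simp add: sum_negf)
      moreover have "(\<Sum>j\<in>I. x j * y j) = ((\<Sum>j\<in>I. x j * u j) - (\<Sum>j\<in>I. x j * v j)) / 2"
        unfolding uv(3) by (simp add: sum_subtractf[symmetric] sum_divide_distrib algebra_simps)
      moreover have "s * t = (a * t - b * t) / 2" unfolding ab(3) by (simp add: algebra_simps)
      ultimately show "(\<Sum>j\<in>I. x j * y j) \<le> c - s * t" using 1 2 by simp
    qed
    then show ?thesis using st by (simp add: sliceB)
  qed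
  define F where "F A = (\<integral>\<^sup>+s. ?\<mu> (slice I i A s) * indicator {0<..} s \<partial>lborel)" for A
  have half: "?\<nu> N = 2 * F N" "?\<nu> M = 2 * F M" "?\<nu> B = 2 * F B"
    unfolding F_def
    by (intro emeasure_even_eq_half_slices I sets N_even M_even; simp add: sliceB)+
  have "?\<nu> K * ?\<nu> L \<le> ?\<nu> N * ?\<nu> M"
    unfolding N_def M_def using I K L
    by (intro mult_mono emeasure_le_steiner emeasure_le_difference_slices) auto
  also have "\<dots> = 4 * (F N * F M)"
    unfolding half by (simp add: ac_simps)
  also have "\<dots> \<le> 4 * (F B)^2"
    unfolding F_def
    by (intro mult_left_mono prekopa_leindler_geometric_mean measurable_emeasure_slice I sets slices) auto
  also have "\<dots> = (?\<nu> B)^2"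
    unfolding half by (simp add: power_mult_distrib)
  finally show ?case unfolding B_def .
qed


text \<open>Transfer along the coordinates with respect to the standard basis. The ball is described by
  the square of its radius, so that \<open>c\<close> may be any real number.\<close>

lemma santalo_euclidean:
  fixes K L :: "'a::euclidean_space set"
  assumes "open K" "open L" and "\<And>x. x \<in> K \<Longrightarrow> - x \<in> K" "\<And>y. y \<in> L \<Longrightarrow> - y \<in> L"
    and "\<And>x y. x \<in> K \<Longrightarrow> y \<in> L \<Longrightarrow> x \<bullet> y \<le> c"
  shows "emeasure lborel K * emeasure lborel L \<le> (emeasure lborel {x::'a. x \<bullet> x \<le> c})^2"
proof -
  define E where "E f = (\<Sum>b\<in>Basis. f b *\<^sub>R b)" for f :: "'a \<Rightarrow> real"
  define P where "P A = {f \<in> Pi\<^sub>E Basis (\<lambda>_. UNIV). E f \<in> A}" for A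
  have inner_Basis: "E f \<bullet> b = f b" if "b \<in> Basis" for f b
    unfolding E_def using that by simp
  have inner: "E f \<bullet> E g = (\<Sum>b\<in>Basis. f b * g b)" for f g
    by (subst euclidean_inner) (simp add: inner_Basis)
  have neg: "E (negate Basis f) = - E f" for f
    unfolding E_def by (simp add: sum_negf)
  have emeasure: "emeasure lborel A = emeasure (lborel_coord Basis) (P A)" if "A \<in> sets borel" for A
  proof -
    have "emeasure lborel A = emeasure (lborel_coord Basis) (E -` A \<inter> space (lborel_coord Basis))"
      unfolding E_def using that by (subst lborel_eq) (rule emeasure_distr; simp)
    also have "E -` A \<inter> space (lborel_coord Basis) = P A"
      by (auto simp: P_def space_PiM)
    finally show ?thesis .
  qed
  have open_P: "coord_open Basis (P A)" if "open A" for A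
    unfolding coord_open_def
  proof (intro conjI ballI)
    fix f assume "f \<in> P A"
    then have "E f \<in> A" by (simp add: P_def)
    then obtain e where e: "0 < e" "ball (E f) e \<subseteq> A" using \<open>open A\<close> open_contains_ball by blast
    have "g \<in> P A" if g: "g \<in> Pi\<^sub>E Basis (\<lambda>_. UNIV)" "\<forall>b\<in>Basis. \<bar>g b - f b\<bar> < e / real DIM('a)" for g
    proof -
      have "norm (E g - E f) \<le> (\<Sum>b\<in>Basis. \<bar>(E g - E f) \<bullet> b\<bar>)" by (rule norm_le_l1)
      also have "\<dots> = (\<Sum>b\<in>Basis. \<bar>g b - f b\<bar>)" by (simp add: inner_diff_left inner_Basis)
      also have "\<dots> < (\<Sum>b\<in>(Basis::'a set). e / real DIM('a))"
        using g(2) by (intro sum_strict_mono) auto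
      also have "\<dots> = e" by simp
      finally have "E g \<in> ball (E f) e" by (simp add: dist_norm norm_minus_commute)
      then show ?thesis using e(2) g(1) by (auto simp: P_def)
    qed
    then show "\<exists>e>0. \<forall>g\<in>Pi\<^sub>E Basis (\<lambda>_. UNIV). (\<forall>b\<in>Basis. \<bar>g b - f b\<bar> < e) \<longrightarrow> g \<in> P A"
      using e(1) by (intro exI[of _ "e / real DIM('a)"]) auto
  qed (auto simp: P_def)
  have "{x::'a. x \<bullet> x \<le> c} \<in> sets borel" by measurable
  moreover have "P {x. x \<bullet> x \<le> c} = coord_cball Basis c"
    by (auto simp: P_def inner)
  moreover have "emeasure (lborel_coord Basis) (P K) * emeasure (lborel_coord Basis) (P L)
      \<le> (emeasure (lborel_coord (Basis :: 'a set)) (coord_cball Basis c))^2"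
  proof (rule santalo_coord)
    fix f assume "f \<in> P K"
    then show "negate Basis f \<in> P K" using assms(3) by (simp add: P_def neg)
  next
    fix f assume "f \<in> P L"
    then show "negate Basis f \<in> P L" using assms(4) by (simp add: P_def neg)
  next
    fix f g assume "f \<in> P K" "g \<in> P L"
    then show "(\<Sum>b\<in>Basis. f b * g b) \<le> c"
      unfolding inner[symmetric] by (intro assms(5)) (auto simp: P_def)
  qed (auto intro: open_P assms)
  ultimately show ?thesis using assms(1,2) by (simp add: emeasure)
qed

text \<open>The bound \<open>r s\<close> on the inner products enters only through the product of the two radii, because
  the volume of a ball is a power of its radius.\<close>

theorem blaschke_santalo:
  fixes K L :: "'a::euclidean_space set"
  assumes KL: "open K" "open L" "\<And>x. x \<in> K \<Longrightarrow> - x \<in> K" "\<And>y. y \<in> L \<Longrightarrow> - y \<in> L"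
    and r: "0 \<le> r" "0 \<le> s"
    and polar: "\<And>x y. x \<in> K \<Longrightarrow> y \<in> L \<Longrightarrow> x \<bullet> y \<le> r * s"
  shows "emeasure lborel K * emeasure lborel L
    \<le> emeasure lborel (ball (0::'a) r) * emeasure lborel (ball (0::'a) s)"
proof -
  have "x \<bullet> x \<le> r * s \<longleftrightarrow> norm x \<le> sqrt (r * s)" for x :: 'a
    by (simp add: norm_eq_sqrt_inner)
  then have "{x::'a. x \<bullet> x \<le> r * s} = cball 0 (sqrt (r * s))"
    by (simp add: set_eq_iff)
  then have "(emeasure lborel {x::'a. x \<bullet> x \<le> r * s})^2
      = (ennreal (unit_ball_vol (real DIM('a)) * sqrt (r * s) ^ DIM('a)))^2"
    using r by (simp add: emeasure_cball)
  also have "\<dots> = ennreal (unit_ball_vol (real DIM('a)) * r ^ DIM('a)) * ennreal (unit_ball_vol (real DIM('a)) * s ^ DIM('a))"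
  proof -
    have "(sqrt (r * s) ^ DIM('a))^2 = r ^ DIM('a) * s ^ DIM('a)"
    proof -
      have "(sqrt (r * s) ^ DIM('a))^2 = ((sqrt (r * s))^2) ^ DIM('a)"
        by (simp only: power_mult[symmetric] mult.commute)
      then show ?thesis using r by (simp add: power_mult_distrib)
    qed
    then show ?thesis
      using r by (simp add: ennreal_power ennreal_mult[symmetric] power_mult_distrib)
        (simp add: power2_eq_square ac_simps)
  qed
  finally show ?thesis
    using santalo_euclidean[OF KL polar] r by (simp add: emeasure_ball)
qed

text \<open>Convex sets have a negligible frontier. This reduces sublevel sets of the transform, which need
  not be open, to their interiors.\<close>

lemma
  fixes S :: "'a::euclidean_space set"
  assumes "convex S"
  shows sets_lebesgue_convex: "S \<in> sets lebesgue"
    and emeasure_convex_eq_interior: "emeasure lebesgue S = emeasure lborel (interior S)"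
proof -
  have neg: "negligible (S \<inter> frontier S)"
    using negligible_convex_frontier[OF assms] by (rule negligible_subset) auto
  have S: "interior S \<union> (S \<inter> frontier S) = S"
    using interior_subset[of S] closure_subset[of S] by (auto simp: frontier_def)
  have "interior S \<union> (S \<inter> frontier S) \<in> sets lebesgue"
    using negligible_imp_sets[OF neg] by (intro sets.Un) auto
  then show "S \<in> sets lebesgue" by (simp add: S)
  have "emeasure lebesgue (interior S \<union> (S \<inter> frontier S)) = emeasure lebesgue (interior S)"
    using neg by (intro emeasure_Un_null_set) (auto simp: negligible_iff_null_sets)
  then show "emeasure lebesgue S = emeasure lborel (interior S)" by (simp add: S)
qed

section \<open>Sublevel sets of the transform\<close>

lemma legendre_transform_le_iff:
  "legendre_transform \<rho> g x \<le> ereal l \<longleftrightarrow> (\<forall>y. \<rho> (x \<bullet> y) \<le> l + g y)"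
  by (simp add: legendre_transform_def SUP_le_iff algebra_simps)

text \<open>For fixed \<open>y\<close> the condition on \<open>x\<close> is that \<open>\<langle>x, y\<rangle>\<close> belongs to a set of reals that is closed
  downwards, and this holds on a half-space, everywhere or nowhere.\<close>

lemma convex_legendre_sublevel:
  assumes "mono \<rho>"
  shows "convex {x. legendre_transform \<rho> g x \<le> ereal l}"
proof (rule convexI, clarsimp simp: legendre_transform_le_iff)
  fix x z y and u v :: real
  assume xz: "\<forall>y. \<rho> (x \<bullet> y) \<le> l + g y" "\<forall>y. \<rho> (z \<bullet> y) \<le> l + g y" and uv: "0 \<le> u" "0 \<le> v" "u + v = 1"
  have "(u *\<^sub>R x + v *\<^sub>R z) \<bullet> y = u * (x \<bullet> y) + v * (z \<bullet> y)" by (simp add: inner_add_left)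
  also have "\<dots> \<le> max (x \<bullet> y) (z \<bullet> y)"
    by (rule convex_bound_le[OF _ _ uv]) auto
  finally have "\<rho> ((u *\<^sub>R x + v *\<^sub>R z) \<bullet> y) \<le> \<rho> (max (x \<bullet> y) (z \<bullet> y))"
    by (rule monoD[OF assms])
  then show "\<rho> ((u *\<^sub>R x + v *\<^sub>R z) \<bullet> y) \<le> l + g y"
    using xz by (auto simp: max_def intro: order_trans split: if_splits)
qed

lemma emeasure_ball_rearr:
  fixes A :: "(real ^ 'n) set"
  shows "emeasure lebesgue (ball_rearr A) = emeasure lebesgue A"
proof (cases "emeasure lebesgue A = \<infinity>")
  case True
  then show ?thesis by (simp add: ball_rearr_def)
next
  case False
  then show ?thesis by (metis ball_rearr_eq_ball)
qed

text \<open>A point \<open>x0\<close> outside the sublevel set for the rearrangement has a witness \<open>y0\<close>. The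
  sublevel set \<open>K\<close> of \<open>f\<close> at height \<open>t = \<rho> \<langle>x0, y0\<rangle> - l\<close> is larger than the ball of radius
  \<open>norm y0\<close>, because \<open>y0\<close> lies in its rearrangement. Monotonicity of \<open>\<rho>\<close> bounds the inner
  products of \<open>K\<close> with the sublevel set for \<open>f\<close> by \<open>norm x0 * norm y0\<close>, so
  the Blaschke-Santalo inequality applies.\<close>

lemma emeasure_legendre_sublevel_le_ball:
  fixes \<rho> :: "real \<Rightarrow> real" and f :: "real ^ 'n \<Rightarrow> real"
  assumes \<rho>: "mono \<rho>" and f: "\<And>x. 0 \<le> f x" "convex_on UNIV f" "\<And>x. f (- x) = f x" "f 0 = 0"
    and x0: "\<not> legendre_transform \<rho> (incr_rearr f) x0 \<le> ereal l"
  shows "emeasure lebesgue {x. legendre_transform \<rho> f x \<le> ereal l} \<le> emeasure lebesgue {x :: real ^ 'n. norm x < norm x0}"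
proof -
  define L where "L = {x. legendre_transform \<rho> f x \<le> ereal l}"
  have L_eq: "emeasure lebesgue L = emeasure lborel (interior L)"
    unfolding L_def by (intro emeasure_convex_eq_interior convex_legendre_sublevel \<rho>)
  have cont: "continuous_on UNIV f"
    by (rule convex_on_continuous[OF open_UNIV f(2)])
  have meas: "f \<in> borel_measurable borel"
    using cont by (rule borel_measurable_continuous_onI)
  obtain y0 where y0: "l + incr_rearr f y0 < \<rho> (x0 \<bullet> y0)"
    using x0 by (auto simp: legendre_transform_le_iff not_le)
  define t where "t = \<rho> (x0 \<bullet> y0) - l"
  define K where "K = {x. f x < t}"
  have "open K" unfolding K_def using cont by (intro open_Collect_less) auto
  have "y0 \<in> {y. incr_rearr f y < t}" using y0 by (simp add: t_def)
  then have "y0 \<in> ball_rearr K" unfolding incr_rearr_sublevel[OF meas f(1)] K_def .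
  then have K_gt: "emeasure lebesgue {x :: real ^ 'n. norm x < norm y0} < emeasure lborel K"
    using \<open>open K\<close> by (simp add: mem_ball_rearr_iff)
  have polar: "y \<bullet> x < x0 \<bullet> y0" if "x \<in> L" "y \<in> K" for x y
  proof -
    have "\<rho> (x \<bullet> y) \<le> l + f y" using that(1) by (simp add: L_def legendre_transform_le_iff)
    also have "\<dots> < \<rho> (x0 \<bullet> y0)" using that(2) by (simp add: K_def t_def)
    finally have "\<rho> (x \<bullet> y) < \<rho> (x0 \<bullet> y0)" .
    then have "\<not> x0 \<bullet> y0 \<le> x \<bullet> y"
      using monoD[OF \<rho>, of "x0 \<bullet> y0" "x \<bullet> y"] by linarith
    then show ?thesis by (simp add: inner_commute)
  qed
  have ball: "{x :: real ^ 'n. norm x < r} = ball 0 r" for r by auto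
  show ?thesis
  proof (cases "L = {}")
    case True
    then show ?thesis unfolding L_def by simp
  next
    case False
    then obtain x where x: "x \<in> L" by auto
    have "K \<noteq> {}" using K_gt by auto
    then obtain y where "f y < t" by (auto simp: K_def)
    then have "0 \<in> K" using f(1)[of y] f(4) by (simp add: K_def)
    \<comment> \<open>with \<open>y0 = 0\<close> the ball around \<open>0\<close> of radius \<open>norm y0\<close> could not be cancelled below\<close>
    from polar[OF x this] have "y0 \<noteq> 0" by auto
    then have pos: "0 < norm y0" by simp
    have ball_pos: "unit_ball_vol (real CARD('n)) \<noteq> 0"
      by (rule less_imp_neq[THEN not_sym, OF unit_ball_vol_pos]) simp
    have "emeasure lborel (ball (0 :: real ^ 'n) (norm y0)) * emeasure lborel (interior L)
        \<le> emeasure lborel K * emeasure lborel (interior L)"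
      using K_gt by (intro mult_right_mono) (auto simp: ball)
    also have "\<dots> \<le> emeasure lborel (ball (0 :: real ^ 'n) (norm y0)) * emeasure lborel (ball (0 :: real ^ 'n) (norm x0))"
    proof (rule blaschke_santalo)
      have "uminus ` L \<subseteq> L"
      proof clarify
        fix x assume "x \<in> L"
        then have "\<forall>y. \<rho> (x \<bullet> y) \<le> l + f y" by (simp add: L_def legendre_transform_le_iff)
        then have "\<rho> (x \<bullet> (- y)) \<le> l + f (- y)" for y by (rule spec)
        then show "- x \<in> L" using f(3) by (simp add: L_def legendre_transform_le_iff)
      qed
      then have "L = uminus ` L" by (force simp: image_iff)
      then have sym: "uminus ` interior L = interior L" by (metis interior_negations)
      show "- x \<in> interior L" if "x \<in> interior L" for x using sym that by blast
      show "- y \<in> K" if "y \<in> K" for y using that f(3) by (simp add: K_def)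
      fix y x assume "y \<in> K" "x \<in> interior L"
      then have "y \<bullet> x < x0 \<bullet> y0" using polar interior_subset by blast
      also have "\<dots> \<le> norm y0 * norm x0" using norm_cauchy_schwarz[of x0 y0] by (simp add: mult.commute)
      finally show "y \<bullet> x \<le> norm y0 * norm x0" by simp
    qed (use \<open>open K\<close> in auto)
    finally have "emeasure lborel (interior L) \<le> emeasure lborel (ball (0 :: real ^ 'n) (norm x0))"
      using pos ball_pos by (subst (asm) ennreal_mult_le_mult_iff) (auto simp: emeasure_ball)
    then show ?thesis using L_eq by (simp add: L_def ball)
  qed
qed

theorem theorem4p1:
  fixes \<rho> :: "real \<Rightarrow> real" and f :: "real ^ 'n \<Rightarrow> real" and l :: real
  assumes "mono \<rho>" and "\<rho> 0 = 0"
    and "\<forall>x. 0 \<le> f x"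
    and "convex_on UNIV f"
    and "\<forall>x. f (- x) = f x"
    and "f 0 = 0"
  shows "emeasure lebesgue {x. legendre_transform \<rho> f x \<le> ereal l}
           \<le> emeasure lebesgue {x. legendre_transform \<rho> (incr_rearr f) x \<le> ereal l}"
proof -
  have "ball_rearr {x. legendre_transform \<rho> f x \<le> ereal l} \<subseteq> {x. legendre_transform \<rho> (incr_rearr f) x \<le> ereal l}"
  proof
    fix x assume "x \<in> ball_rearr {x. legendre_transform \<rho> f x \<le> ereal l}"
    then have "\<not> emeasure lebesgue {x. legendre_transform \<rho> f x \<le> ereal l} \<le> emeasure lebesgue {z :: real ^ 'n. norm z < norm x}"
      by (simp add: mem_ball_rearr_iff not_le)
    then show "x \<in> {x. legendre_transform \<rho> (incr_rearr f) x \<le> ereal l}"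
      using emeasure_legendre_sublevel_le_ball[of \<rho> f x l] assms by blast
  qed
  then have "emeasure lebesgue (ball_rearr {x. legendre_transform \<rho> f x \<le> ereal l})
      \<le> emeasure lebesgue {x. legendre_transform \<rho> (incr_rearr f) x \<le> ereal l}"
    by (intro emeasure_mono sets_lebesgue_convex convex_legendre_sublevel assms)
  then show ?thesis by (simp only: emeasure_ball_rearr)
qed

end
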